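(* Let $u>\theta>0$ and $c,C>0$. There is $\alpha=\alpha(\theta,c,u,C)>1$ such that the following holds. Suppose $f_1,\ldots,f_m:\mathbb{R}\to\mathbb{R}_+$ are each lower $\theta$-homogeneous with constant $c$ and upper $u$-homogeneous with constant $C$. Then for every choice of nonzero vectors $a_1,\ldots,a_m\in\mathbb{R}^n$ spanning $\mathbb{R}^n$ and every $s>0$, there is an $\alpha$-approximate weight at scale $s$ (for $\{f_i\}$, $\{a_i\}$).
   Context: $f$ is lower $\theta$-homogeneous with constant $c$ if $f(\lambda z)\ge c\lambda^\theta f(z)$ for all $z$ and $\lambda\ge1$; upper $u$-homogeneous with constant $C$ if $f(\lambda z)\le C\lambda^u f(z)$ for all $z$ and $\lambda\ge1$. For $w\in\mathbb{R}_+^m$ let $M_w:=\sum_{j=1}^m w_ja_ja_j^\top$. A vector $w\in\mathbb{R}_+^m$ is an $\alpha$-approximate weight at scale $s$ if $M_w$ is invertible, each $w_i>0$, and \[ \frac{s}{\alpha}\le\frac{f_i(\|M_w^{-1/2}a_i\|_2)}{w_i\|M_w^{-1/2}a_i\|_2^2}\le\alpha s,\qquad i=1,\ldots,m. \]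
   Formalization: Each f_i is additionally assumed not to vanish identically on (0,∞); without this the claim fails (f_i = 0 satisfies both homogeneity conditions but admits no approximate weight), and the condition is necessary for the conclusion. *)

theory Defs
  imports
    Complex_Main
    "Jordan_Normal_Form.Gauss_Jordan_Elimination"
    "Jordan_Normal_Form.VS_Connect"
begin

definition lower_homogeneous :: "real \<Rightarrow> real \<Rightarrow> (real \<Rightarrow> real) \<Rightarrow> bool" where
  "lower_homogeneous \<theta> c f \<longleftrightarrow>
     (\<forall>z. \<forall>r\<ge>1. f (r * z) \<ge> c * r powr \<theta> * f z)"

definition upper_homogeneous :: "real \<Rightarrow> real \<Rightarrow> (real \<Rightarrow> real) \<Rightarrow> bool" where
  "upper_homogeneous u C f \<longleftrightarrow>
     (\<forall>z. \<forall>r\<ge>1. f (r * z) \<le> C * r powr u * f z)"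

text \<open>The dimension is a term-level number (vectors and matrices with explicit carriers) rather
  than a type, since the constant of the main theorem must be uniform in it.\<close>

abbreviation vec_span :: "nat \<Rightarrow> real vec set \<Rightarrow> real vec set" where
  "vec_span n S \<equiv> LinearCombinations.module.span class_ring (module_vec TYPE(real) n) S"

definition norm2 :: "real vec \<Rightarrow> real" where
  "norm2 v = sqrt (v \<bullet> v)"

definition psd_mat :: "nat \<Rightarrow> real mat \<Rightarrow> bool" where
  "psd_mat n A \<longleftrightarrow>
     A \<in> carrier_mat n n \<and> transpose_mat A = A \<and> (\<forall>v \<in> carrier_vec n. v \<bullet> (A *\<^sub>v v) \<ge> 0)"

text \<open>The principal square root; meaningful for symmetric positive semidefinite arguments, which
  have exactly one positive semidefinite square root.\<close>

definition sqrt_mat :: "real mat \<Rightarrow> real mat" where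
  "sqrt_mat A = (THE B. psd_mat (dim_row A) B \<and> B * B = A)"

text \<open>Meaningful for invertible arguments, for which \<^const>\<open>mat_inverse\<close> is not \<^const>\<open>None\<close>.\<close>

definition inv_sqrt_mat :: "real mat \<Rightarrow> real mat" where
  "inv_sqrt_mat M = sqrt_mat (the (mat_inverse M))"

definition weight_mat :: "nat \<Rightarrow> nat \<Rightarrow> (nat \<Rightarrow> real vec) \<Rightarrow> real vec \<Rightarrow> real mat" where
  "weight_mat n m a w = mat n n (\<lambda>(k, l). \<Sum>j<m. w $ j * (a j $ k * a j $ l))"

text \<open>The indices \<open>1, \<dots>, m\<close> are shifted to \<open>0, \<dots>, m - 1\<close>.\<close>

definition approximate_weight ::
  "nat \<Rightarrow> nat \<Rightarrow> (nat \<Rightarrow> real \<Rightarrow> real) \<Rightarrow> (nat \<Rightarrow> real vec) \<Rightarrow> real \<Rightarrow> real \<Rightarrow> real vec \<Rightarrow> bool"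
where
  "approximate_weight n m f a \<alpha> s w \<longleftrightarrow>
     w \<in> carrier_vec m \<and>
     invertible_mat (weight_mat n m a w) \<and>
     (\<forall>i<m. w $ i > 0) \<and>
     (\<forall>i<m. let t = norm2 (inv_sqrt_mat (weight_mat n m a w) *\<^sub>v a i)
            in s / \<alpha> \<le> f i t / (w $ i * t\<^sup>2) \<and> f i t / (w $ i * t\<^sup>2) \<le> \<alpha> * s)"

text \<open>A function that vanishes on the positive half-line may satisfy both homogeneity conditions
  (the zero function does), but it never admits an approximate weight. Hence the main theorem has
  to assume that no \<open>f i\<close> does so.\<close>

lemma approximate_weight_imp_nonzero:
  assumes "approximate_weight n m f a \<alpha> s w" and "s > 0" and "\<alpha> > 0" and "i < m"
  shows "\<exists>z>0. f i z \<noteq> 0"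
proof -
  define v where "v = inv_sqrt_mat (weight_mat n m a w) *\<^sub>v a i"
  have "s / \<alpha> \<le> f i (norm2 v) / (w $ i * (norm2 v)\<^sup>2)"
    using assms(1,4) by (simp add: approximate_weight_def Let_def v_def)
  moreover have "s / \<alpha> > 0"
    using assms(2,3) by simp
  ultimately have "f i (norm2 v) \<noteq> 0" and "norm2 v \<noteq> 0"
    by auto
  moreover have "norm2 v \<ge> 0"
    by (auto simp: norm2_def scalar_prod_def intro!: sum_nonneg)
  ultimately show ?thesis
    by (intro exI[of _ "norm2 v"]) auto
qed

end

theory Submission
  imports "HOL-Analysis.Interval_Integral" "HOL-Real_Asymp.Real_Asymp" Defs
begin

text \<open>
  The weights come from a generalised John position. Each \<open>f\<^sub>i\<close> is replaced by a comparable
  continuous function \<open>g\<^sub>i\<close>, and \<open>G\<^sub>i\<close> is chosen with \<open>t G\<^sub>i'(t) = g\<^sub>i(t)\<close>. Lower homogeneity makes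
  \<open>G\<^sub>i\<close> grow like a power, so \<open>ln \<bar>det U\<bar> - (1/s) \<Sum>\<^sub>i G\<^sub>i(\<bar>U a\<^sub>i\<bar>)\<close> attains its maximum over the
  invertible positive semidefinite matrices \<open>U\<close>. With \<open>w\<^sub>i = g\<^sub>i(t\<^sub>i) / (s t\<^sub>i\<^sup>2)\<close> and \<open>t\<^sub>i = \<bar>U a\<^sub>i\<bar>\<close>, the
  critical point equation says \<open>U M\<^sub>w U = I\<close>. So \<open>U\<close> is the inverse square root of \<open>M\<^sub>w\<close>, and \<open>w\<close>
  is an exact weight for the \<open>g\<^sub>i\<close>.
\<close>

hide_type (open) Finite_Cartesian_Product.vec
unbundle no vec_syntax

section \<open>Smoothing a homogeneous function\<close>

lemma lower_homogeneousD:
  assumes "lower_homogeneous \<theta> c f" "0 < x" "x \<le> t"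
  shows "c * (t / x) powr \<theta> * f x \<le> f t"
  using assms(1)[unfolded lower_homogeneous_def, rule_format, of "t / x" x] assms(2,3)
  by simp

lemma upper_homogeneousD:
  assumes "upper_homogeneous u C f" "0 < x" "x \<le> t"
  shows "f t \<le> C * (t / x) powr u * f x"
  using assms(1)[unfolded upper_homogeneous_def, rule_format, of "t / x" x] assms(2,3)
  by simp

text \<open>A single point \<open>z\<close> with \<open>f z > 0\<close> spreads positivity over the
  half-line: lower homogeneity carries it to the right of \<open>z\<close>, and upper homogeneity
  forbids a zero to the left of \<open>z\<close>.\<close>

lemma homogeneous_pos:
  assumes "0 < c" "0 < C" "\<And>z. 0 \<le> f z" "\<exists>z>0. f z \<noteq> 0"
    and lo: "lower_homogeneous \<theta> c f" and up: "upper_homogeneous u C f" and t: "0 < t"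
  shows "0 < f t"
proof -
  obtain z where z: "0 < z" "0 < f z"
    using assms(3,4) by (metis order_le_less)
  show ?thesis
  proof (cases "z \<le> t")
    case True
    have "0 < c * (t / z) powr \<theta> * f z"
      using z t \<open>0 < c\<close> by simp
    then show ?thesis
      using lower_homogeneousD[OF lo z(1) True] by linarith
  next
    case False
    then have "0 < C * (z / t) powr u * f t"
      using upper_homogeneousD[OF up t, of z] z by linarith
    then show ?thesis
      using assms(3)[of t] by (auto simp: order_le_less)
  qed
qed

text \<open>Every function under the supremum is nondecreasing in \<open>t\<close> and grows at most like \<open>t\<^sup>u\<close>. The
  envelope inherits both properties, and together they force continuity, which \<open>f\<close> need not have.\<close>

definition envelope :: "real \<Rightarrow> (real \<Rightarrow> real) \<Rightarrow> real \<Rightarrow> real" where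
  "envelope u f t = (SUP x\<in>{0<..}. f x * min 1 ((t / x) powr u))"

context
  fixes f :: "real \<Rightarrow> real" and \<theta> u c C :: real
  assumes pos: "0 < \<theta>" "0 < u" "0 < c" "0 < C"
    and nonneg: "\<And>z. 0 \<le> f z"
    and lo: "lower_homogeneous \<theta> c f" and up: "upper_homogeneous u C f"
begin

text \<open>To the left of \<open>t\<close>, lower homogeneity with
  \<open>(t / x) powr \<theta> \<ge> 1\<close> costs only the factor \<open>1 / c\<close>. To the
  right, the decaying factor cancels the growth allowed by upper homogeneity and leaves
  \<open>C\<close>. The resulting factor involves neither \<open>f\<close> nor \<open>t\<close>,
  which is what makes the final \<alpha> uniform.\<close>

lemma envelope_summand_le:
  assumes "0 < t" "0 < x"
  shows "f x * min 1 ((t / x) powr u) \<le> max (1 / c) C * f t"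
proof (cases "x \<le> t")
  case True
  have "c * 1 * f x \<le> c * (t / x) powr \<theta> * f x"
    using True assms pos nonneg by (intro mult_right_mono mult_left_mono ge_one_powr_ge_zero) auto
  also have "\<dots> \<le> f t"
    by (rule lower_homogeneousD[OF lo \<open>0 < x\<close> True])
  finally have "f x \<le> 1 / c * f t"
    using pos by (simp add: field_simps)
  then have "f x * min 1 ((t / x) powr u) \<le> 1 / c * f t"
    using nonneg[of x] by (meson min.cobounded1 mult_left_le order_trans)
  also have "\<dots> \<le> max (1 / c) C * f t"
    by (intro mult_right_mono nonneg) auto
  finally show ?thesis .
next
  case False
  have "f x * min 1 ((t / x) powr u) \<le> f x * (t / x) powr u"
    by (intro mult_left_mono nonneg) auto
  also have "\<dots> \<le> (C * (x / t) powr u * f t) * (t / x) powr u"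
    using False by (intro mult_right_mono upper_homogeneousD[OF up \<open>0 < t\<close>]) auto
  also have "\<dots> = C * f t * ((x / t) powr u * (t / x) powr u)"
    by (simp add: mult_ac)
  also have "(x / t) powr u * (t / x) powr u = 1"
    using assms by (simp flip: powr_mult)
  also have "C * f t * 1 \<le> max (1 / c) C * f t"
    by (simp add: mult_right_mono nonneg)
  finally show ?thesis .
qed

lemma envelope_bdd:
  assumes "0 < t"
  shows "bdd_above ((\<lambda>x. f x * min 1 ((t / x) powr u)) ` {0<..})"
  by (rule bdd_aboveI2[of _ _ "max (1 / c) C * f t"]) (use envelope_summand_le assms in auto)

lemma envelope_upper: "0 < t \<Longrightarrow> envelope u f t \<le> max (1 / c) C * f t"
  unfolding envelope_def by (rule cSUP_least) (use envelope_summand_le in auto)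

lemma envelope_lower:
  assumes "0 < t"
  shows "f t \<le> envelope u f t"
proof -
  have "f t = f t * min 1 ((t / t) powr u)"
    using assms by simp
  also have "\<dots> \<le> envelope u f t"
    unfolding envelope_def using assms by (intro cSUP_upper envelope_bdd) auto
  finally show ?thesis .
qed

lemma envelope_mono:
  assumes "0 < x" "x \<le> y"
  shows "envelope u f x \<le> envelope u f y"
  unfolding envelope_def
proof (rule cSUP_mono)
  fix z :: real assume "z \<in> {0<..}"
  then show "\<exists>z'\<in>{0<..}. f z * min 1 ((x / z) powr u) \<le> f z' * min 1 ((y / z') powr u)"
    using assms pos
    by (intro bexI[of _ z] mult_left_mono nonneg min.mono powr_mono2 divide_right_mono) auto
qed (use assms envelope_bdd in auto)

text \<open>Passing from \<open>x\<close> to \<open>y\<close> multiplies the inner power by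
  \<open>(y / x) powr u \<ge> 1\<close>, and a factor of at least 1 can be pulled out of a
  truncation at 1. So the growth bound holds summand by summand, with constant 1 in place of
  \<open>C\<close>.\<close>

lemma envelope_growth:
  assumes "0 < x" "x \<le> y"
  shows "envelope u f y \<le> (y / x) powr u * envelope u f x"
  unfolding envelope_def[of _ _ y]
proof (rule cSUP_least)
  fix z :: real assume z: "z \<in> {0<..}"
  have r: "1 \<le> (y / x) powr u"
    using assms pos by (intro ge_one_powr_ge_zero) auto
  have "(y / z) powr u = (y / x) powr u * (x / z) powr u"
    using assms z by (simp flip: powr_mult)
  then have "min 1 ((y / z) powr u) \<le> (y / x) powr u * min 1 ((x / z) powr u)"
    using r by (auto simp: min_def)
  then have "f z * min 1 ((y / z) powr u) \<le> f z * ((y / x) powr u * min 1 ((x / z) powr u))"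
    by (intro mult_left_mono nonneg)
  also have "\<dots> = (y / x) powr u * (f z * min 1 ((x / z) powr u))"
    by (simp add: mult_ac)
  also have "\<dots> \<le> (y / x) powr u * envelope u f x"
    unfolding envelope_def using assms z r
    by (intro mult_left_mono cSUP_upper envelope_bdd) auto
  finally show "f z * min 1 ((y / z) powr u) \<le> (y / x) powr u * envelope u f x" .
qed auto

text \<open>By monotonicity and the growth bound, the ratio of the values at \<open>x\<close> and
  \<open>t\<close> lies between 1 and \<open>(x / t) powr u\<close>, on either side of
  \<open>t\<close>. Both bounds tend to 1.\<close>

lemma isCont_envelope:
  assumes "0 < t"
  shows "isCont (envelope u f) t"
proof -
  let ?g = "envelope u f"
  have g0: "0 \<le> ?g x" if "0 < x" for x
    using envelope_lower[OF that] nonneg[of x] by linarith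
  have ev: "\<forall>\<^sub>F x in at t. 0 < x"
    using assms by (intro order_tendstoD) auto
  have "((\<lambda>x. min 1 ((x / t) powr u) * ?g t) \<longlongrightarrow> min 1 ((t / t) powr u) * ?g t) (at t)"
    using assms by (intro tendsto_intros) auto
  then have l: "((\<lambda>x. min 1 ((x / t) powr u) * ?g t) \<longlongrightarrow> ?g t) (at t)"
    using assms by simp
  have "((\<lambda>x. max 1 ((x / t) powr u) * ?g t) \<longlongrightarrow> max 1 ((t / t) powr u) * ?g t) (at t)"
    using assms by (intro tendsto_intros) auto
  then have r: "((\<lambda>x. max 1 ((x / t) powr u) * ?g t) \<longlongrightarrow> ?g t) (at t)"
    using assms by simp
  have "(?g \<longlongrightarrow> ?g t) (at t)"
  proof (rule tendsto_sandwich[OF _ _ l r])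
    show "\<forall>\<^sub>F x in at t. min 1 ((x / t) powr u) * ?g t \<le> ?g x"
    proof (rule eventually_mono[OF ev])
      fix x :: real assume x: "0 < x"
      show "min 1 ((x / t) powr u) * ?g t \<le> ?g x"
      proof (cases "x \<le> t")
        case True
        have "min 1 ((x / t) powr u) * ?g t \<le> (x / t) powr u * ?g t"
          by (intro mult_right_mono g0 assms) auto
        also have "\<dots> \<le> (x / t) powr u * ((t / x) powr u * ?g x)"
          by (intro mult_left_mono envelope_growth x True) auto
        also have "\<dots> = ((x / t) powr u * (t / x) powr u) * ?g x"
          by simp
        also have "(x / t) powr u * (t / x) powr u = 1"
          using assms x by (simp flip: powr_mult)
        finally show ?thesis by simp
      next
        case False
        have "min 1 ((x / t) powr u) * ?g t \<le> 1 * ?g t"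
          by (intro mult_right_mono g0 assms) auto
        also have "\<dots> \<le> ?g x"
          using envelope_mono[OF assms, of x] False by simp
        finally show ?thesis .
      qed
    qed
    show "\<forall>\<^sub>F x in at t. ?g x \<le> max 1 ((x / t) powr u) * ?g t"
    proof (rule eventually_mono[OF ev])
      fix x :: real assume x: "0 < x"
      show "?g x \<le> max 1 ((x / t) powr u) * ?g t"
      proof (cases "x \<le> t")
        case True
        have "?g x \<le> 1 * ?g t"
          using envelope_mono[OF x True] by simp
        also have "\<dots> \<le> max 1 ((x / t) powr u) * ?g t"
          by (intro mult_right_mono g0 assms) auto
        finally show ?thesis .
      next
        case False
        have "?g x \<le> (x / t) powr u * ?g t"
          using envelope_growth[OF assms, of x] False by simp
        also have "\<dots> \<le> max 1 ((x / t) powr u) * ?g t"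
          by (intro mult_right_mono g0 assms) auto
        finally show ?thesis .
      qed
    qed
  qed
  then show ?thesis
    by (simp add: isCont_def)
qed

text \<open>\<open>g\<close> is the envelope and \<open>G\<close> an antiderivative of
  \<open>g t / t\<close>. The lower bound on \<open>G\<close> supplies the coercivity of the
  variational problem; \<epsilon> and \<open>K\<close> may depend on \<open>f\<close>, whereas the
  comparison of \<open>g\<close> with \<open>f\<close> may not.\<close>

lemma homogeneous_potential:
  assumes ne: "\<exists>z>0. f z \<noteq> 0"
  shows "\<exists>G g \<epsilon> K. 0 < \<epsilon> \<and> (\<forall>t>0. (G has_real_derivative g t / t) (at t) \<and> 0 < f t \<and>
      f t \<le> g t \<and> g t \<le> max (1 / c) C * f t \<and> \<epsilon> * t powr \<theta> - K \<le> G t)"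
proof -
  define g where "g = envelope u f"
  have fpos: "0 < f t" if "0 < t" for t
    by (rule homogeneous_pos[OF pos(3,4) nonneg ne lo up that])
  have "\<exists>G. \<forall>t. 0 < ereal t \<longrightarrow> ereal t < \<infinity> \<longrightarrow> (G has_vector_derivative g t / t) (at t)"
    unfolding g_def
    by (rule einterval_antiderivative) (auto intro!: continuous_intros isCont_envelope)
  then obtain G where G: "(G has_real_derivative g t / t) (at t)" if "0 < t" for t
    by (auto simp: has_real_derivative_iff_has_vector_derivative)
  \<comment> \<open>Lower homogeneity between 1 and \<open>t\<close> gives both constants: for
    \<open>t \<ge> 1\<close> it bounds \<open>g\<close> from below by
    \<open>k * t powr \<theta>\<close>, for \<open>t \<le> 1\<close> it bounds \<open>g\<close> from
    above by \<open>k' * t powr \<theta>\<close>.\<close>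
  define k where "k = c * f 1"
  define k' where "k' = max (1 / c) C * (f 1 / c)"
  have k: "0 < k" "0 < k'"
    using fpos[of 1] pos by (auto simp: k_def k'_def max_def)
  have hi: "k * t powr \<theta> \<le> g t" if "1 \<le> t" for t
    using lower_homogeneousD[OF lo, of 1 t] envelope_lower[of t] that
    by (simp add: k_def g_def mult_ac)
  have lw: "g t \<le> k' * t powr \<theta>" if t: "0 < t" "t \<le> 1" for t
  proof -
    have "c * (1 / t) powr \<theta> * f t \<le> f 1"
      by (rule lower_homogeneousD[OF lo t])
    then have "f t \<le> f 1 / c * t powr \<theta>"
      using t pos by (simp add: powr_divide field_simps)
    then have "max (1 / c) C * f t \<le> max (1 / c) C * (f 1 / c * t powr \<theta>)"
      using pos by (intro mult_left_mono) (auto simp: max_def)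
    then show ?thesis
      using envelope_upper[OF t(1)] by (simp add: g_def k'_def mult_ac)
  qed
  have D: "((\<lambda>t. G t - b / \<theta> * t powr \<theta>) has_real_derivative (g t - b * t powr \<theta>) / t) (at t)"
    if "0 < t" for b t
    using that pos
    by (auto intro!: derivative_eq_intros G simp: field_simps powr_diff)
  \<comment> \<open>Right of 1, \<open>G\<close> grows at least as fast as
    \<open>k / \<theta> * t powr \<theta>\<close>. Left of 1, the upper bound on \<open>g\<close>
    makes \<open>g t / t\<close> integrable at 0, so \<open>G\<close> drops by at most
    \<open>k' / \<theta>\<close> below \<open>G 1\<close>.\<close>
  have "k / \<theta> * t powr \<theta> - (k / \<theta> + k' / \<theta> - G 1) \<le> G t" if t: "0 < t" for t
  proof (cases "1 \<le> t")
    case True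
    have "G 1 - k / \<theta> * 1 powr \<theta> \<le> G t - k / \<theta> * t powr \<theta>"
    proof (rule DERIV_nonneg_imp_nondecreasing[OF True])
      fix x assume "1 \<le> x" "x \<le> t"
      then show "\<exists>y. ((\<lambda>t. G t - k / \<theta> * t powr \<theta>) has_real_derivative y) (at x) \<and> 0 \<le> y"
        using hi[of x] by (intro exI[of _ "(g x - k * x powr \<theta>) / x"] conjI D) auto
    qed
    moreover have "0 \<le> k' / \<theta>"
      using pos k by simp
    ultimately show ?thesis
      by simp
  next
    case False
    have "G 1 - k' / \<theta> * 1 powr \<theta> \<le> G t - k' / \<theta> * t powr \<theta>"
    proof (rule DERIV_nonpos_imp_nonincreasing[of t 1])
      fix x assume "t \<le> x" "x \<le> 1"
      then show "\<exists>y. ((\<lambda>t. G t - k' / \<theta> * t powr \<theta>) has_real_derivative y) (at x) \<and> y \<le> 0"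
        using lw[of x] t
        by (intro exI[of _ "(g x - k' * x powr \<theta>) / x"] conjI D) (auto simp: divide_nonpos_pos)
    qed (use False in auto)
    moreover have "k / \<theta> * t powr \<theta> \<le> k / \<theta>"
      using False t pos k by (intro mult_left_le powr_le1) auto
    moreover have "0 \<le> k' / \<theta> * t powr \<theta>"
      using pos k by simp
    ultimately show ?thesis
      by simp
  qed
  then show ?thesis
    by - (rule exI[of _ G], rule exI[of _ g], rule exI[of _ "k / \<theta>"],
        rule exI[of _ "k / \<theta> + k' / \<theta> - G 1"],
        use G fpos envelope_lower envelope_upper pos k in \<open>auto simp: g_def\<close>)
qed

end

section \<open>Positive semidefinite matrices\<close>

lemmas square_carrier = mult_carrier_mat[of _ n n _ n] mult_mat_vec_carrier[of _ n n]
  transpose_carrier_mat[of _ n n] for n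

lemmas square_assoc = assoc_mult_mat[of _ n n _ n _ n] assoc_mult_mat_vec[of _ n n _ n] for n

lemma scalar_prod_self_nonneg: "0 \<le> v \<bullet> (v :: real vec)"
  by (auto simp: scalar_prod_def intro!: sum_nonneg)

lemma scalar_prod_self_eq_0_iff:
  assumes "v \<in> carrier_vec n"
  shows "v \<bullet> v = 0 \<longleftrightarrow> v = (0\<^sub>v n :: real vec)"
proof
  assume "v \<bullet> v = 0"
  then have "\<forall>i\<in>{0..<n}. v $ i * v $ i = 0"
    using assms by (subst (asm) scalar_prod_def, subst (asm) sum_nonneg_eq_0_iff) auto
  then show "v = 0\<^sub>v n"
    using assms by (intro eq_vecI) auto
qed (use assms in simp)

lemma norm2_nonneg: "0 \<le> norm2 v"
  by (simp add: norm2_def scalar_prod_self_nonneg)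

lemma norm2_pos:
  assumes "v \<in> carrier_vec n" "v \<noteq> 0\<^sub>v n"
  shows "0 < norm2 v"
  using assms scalar_prod_self_nonneg[of v] scalar_prod_self_eq_0_iff[of v n]
  by (simp add: norm2_def order_le_less)

lemma abs_index_le_norm2:
  assumes "i < dim_vec v"
  shows "\<bar>v $ i\<bar> \<le> norm2 v"
proof -
  have "(v $ i)\<^sup>2 \<le> v \<bullet> v"
    unfolding scalar_prod_def power2_eq_square
    using assms by (intro member_le_sum[of i _ "\<lambda>i. v $ i * v $ i"]) auto
  then show ?thesis
    unfolding norm2_def by (simp flip: real_sqrt_abs)
qed

lemma psd_matD:
  assumes "psd_mat n A"
  shows "A \<in> carrier_mat n n" "transpose_mat A = A" "v \<in> carrier_vec n \<Longrightarrow> 0 \<le> v \<bullet> (A *\<^sub>v v)"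
  using assms by (auto simp: psd_mat_def)

lemma psd_mat_one: "psd_mat n (1\<^sub>m n)"
  by (simp add: psd_mat_def scalar_prod_self_nonneg)

lemma symmetric_scalar_prod:
  fixes A :: "'a :: comm_semiring_0 mat"
  assumes "A \<in> carrier_mat n n" "transpose_mat A = A" "v \<in> carrier_vec n" "w \<in> carrier_vec n"
  shows "(A *\<^sub>v v) \<bullet> w = v \<bullet> (A *\<^sub>v w)"
  using transpose_vec_mult_scalar[OF assms(1,4,3)] assms(2) by simp

lemma psd_mat_congruence:
  assumes "psd_mat n A" "F \<in> carrier_mat n n"
  shows "psd_mat n (F * A * transpose_mat F)"
proof -
  note [simp] = psd_matD(1,2)[OF assms(1)] assms(2) square_carrier square_assoc[where n = n]
  have "v \<bullet> ((F * A * transpose_mat F) *\<^sub>v v)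
      = (transpose_mat F *\<^sub>v v) \<bullet> (A *\<^sub>v (transpose_mat F *\<^sub>v v))"
    if v: "v \<in> carrier_vec n" for v
  proof -
    have "(F * A * transpose_mat F) *\<^sub>v v = F *\<^sub>v (A *\<^sub>v (transpose_mat F *\<^sub>v v))"
      using v by simp
    then show ?thesis
      using v by (subst transpose_vec_mult_scalar[of F n n]) auto
  qed
  moreover have "transpose_mat (F * A * transpose_mat F) = F * A * transpose_mat F"
    by (simp add: transpose_mult[of _ n n _ n])
  ultimately show ?thesis
    using psd_matD(3)[OF assms(1)] by (auto simp: psd_mat_def)
qed

text \<open>The quadratic form is nonnegative along the line through \<open>v\<close> in direction \<open>A v\<close>, and its
  derivative there is \<open>2 |A v|\<^sup>2\<close>.\<close>

lemma psd_mat_isotropic: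
  assumes A: "psd_mat n A" and v: "v \<in> carrier_vec n" and 0: "v \<bullet> (A *\<^sub>v v) = 0"
  shows "A *\<^sub>v v = 0\<^sub>v n"
proof -
  note [simp] = psd_matD(1,2)[OF A] v square_carrier
  define w where "w = A *\<^sub>v v"
  have [simp]: "w \<in> carrier_vec n"
    by (simp add: w_def)
  define p q where "p = w \<bullet> w" and "q = w \<bullet> (A *\<^sub>v w)"
  have pq: "0 \<le> p" "0 \<le> q"
    by (auto simp: p_def q_def scalar_prod_self_nonneg psd_matD(3)[OF A])
  have expand: "(v + x \<cdot>\<^sub>v w) \<bullet> (A *\<^sub>v (v + x \<cdot>\<^sub>v w)) = 2 * x * p + x\<^sup>2 * q" for x
  proof -
    have "A *\<^sub>v (v + x \<cdot>\<^sub>v w) = w + x \<cdot>\<^sub>v (A *\<^sub>v w)"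
      by (simp add: mult_add_distrib_mat_vec[of _ n n] mult_mat_vec[of _ n n] w_def)
    moreover have "v \<bullet> (A *\<^sub>v w) = p"
      using symmetric_scalar_prod[of A n v w] by (simp add: p_def w_def)
    moreover have "v \<bullet> w = 0"
      using 0 by (simp add: w_def)
    moreover have "A *\<^sub>v w \<in> carrier_vec n"
      by simp
    ultimately show ?thesis
      by (simp add: add_scalar_prod_distrib[of _ n] scalar_prod_add_distrib[of _ n]
          smult_scalar_prod_distrib[of _ n] scalar_prod_smult_distrib[of _ n] p_def q_def
          power2_eq_square algebra_simps)
  qed
  have "0 \<le> (v + x \<cdot>\<^sub>v w) \<bullet> (A *\<^sub>v (v + x \<cdot>\<^sub>v w))" for x
    by (rule psd_matD(3)[OF A]) simp
  then have ineq: "0 \<le> 2 * (- y) * p + (- y)\<^sup>2 * q" for y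
    unfolding expand .
  \<comment> \<open>With \<open>p = y * (q + 1)\<close>, the form at parameter \<open>- y\<close>
    equals \<open>- y\<^sup>2 * (q + 2)\<close>, so nonnegativity forces \<open>y = 0\<close>.
    Dividing by \<open>q + 1\<close> also covers \<open>q = 0\<close>.\<close>
  define y where "y = p / (q + 1)"
  have y: "p = y * (q + 1)"
    using pq by (simp add: y_def)
  have "y\<^sup>2 * (q + 2) = 2 * y * (y * (q + 1)) - y\<^sup>2 * q"
    by (simp add: power2_eq_square algebra_simps)
  also have "\<dots> = 2 * y * p - y\<^sup>2 * q"
    by (simp flip: y)
  also have "\<dots> \<le> 0"
    using ineq[of y] by simp
  finally have "y\<^sup>2 * (q + 2) \<le> 0" .
  then have "y = 0"
    using pq(2) by (simp add: mult_le_0_iff)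
  then have "p = 0"
    using y by simp
  then show ?thesis
    using scalar_prod_self_eq_0_iff[of w n] by (simp add: p_def w_def)
qed

lemma psd_mat_definite:
  assumes "psd_mat n A" "det A \<noteq> 0" "v \<in> carrier_vec n" "v \<bullet> (A *\<^sub>v v) = 0"
  shows "v = 0\<^sub>v n"
  using psd_mat_isotropic[OF assms(1,3,4)] assms det_0_iff_vec_prod_zero_field[of A n]
    psd_matD(1)[OF assms(1)] by blast

lemma sum_diag_mult_commute:
  fixes A B :: "'a :: comm_semiring_0 mat"
  assumes "A \<in> carrier_mat n k" "B \<in> carrier_mat k n"
  shows "(\<Sum>i<n. (A * B) $$ (i, i)) = (\<Sum>i<k. (B * A) $$ (i, i))"
proof -
  have "(\<Sum>i<n. (A * B) $$ (i, i)) = (\<Sum>i<n. \<Sum>j<k. A $$ (i, j) * B $$ (j, i))"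
    using assms by (intro sum.cong) (auto simp: scalar_prod_def atLeast0LessThan)
  also have "\<dots> = (\<Sum>j<k. \<Sum>i<n. B $$ (j, i) * A $$ (i, j))"
    by (subst sum.swap) (simp add: mult.commute)
  also have "\<dots> = (\<Sum>i<k. (B * A) $$ (i, i))"
    using assms by (intro sum.cong) (auto simp: scalar_prod_def atLeast0LessThan)
  finally show ?thesis .
qed

text \<open>Multiplying by \<open>X\<close> and taking traces turns the equation into
  \<open>tr (X B X) + tr (X D X) = 0\<close> with both terms nonnegative.\<close>

lemma psd_sylvester_unique:
  assumes B: "psd_mat n B" "det B \<noteq> 0" and D: "psd_mat n D"
    and X: "X \<in> carrier_mat n n" "transpose_mat X = X"
    and eq: "B * X + X * D = 0\<^sub>m n n"
  shows "X = 0\<^sub>m n n"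
proof -
  note [simp] = psd_matD(1)[OF B(1)] psd_matD(1)[OF D] X(1) square_carrier square_assoc[where n = n]
  have diag: "(X * (A * X)) $$ (i, i) = col X i \<bullet> (A *\<^sub>v col X i)"
    if "A \<in> carrier_mat n n" "i < n" for A i
  proof -
    have "row X i = col X i"
      using row_transpose[of i X] X that by simp
    moreover have "col (A * X) i = A *\<^sub>v col X i"
      by (rule col_mult2[of _ n n _ n]) (use that in auto)
    moreover have "(X * (A * X)) $$ (i, i) = row X i \<bullet> col (A * X) i"
      by (rule index_mult_mat(1)) (use that carrier_matD[OF X(1)] in auto)
    ultimately show ?thesis
      by (simp only:)
  qed
  \<comment> \<open>Cyclicity of the trace moves one \<open>X\<close> to the other side of
    \<open>D\<close>, which turns the second term into a sum of values of the quadratic form of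
    \<open>D\<close>.\<close>
  have "X * (X * D) = X * X * D"
    by simp
  then have "(\<Sum>i<n. (X * (X * D)) $$ (i, i)) = (\<Sum>i<n. (X * (D * X)) $$ (i, i))"
    using sum_diag_mult_commute[of X n n "X * D"] by simp
  moreover have "(\<Sum>i<n. (X * (B * X)) $$ (i, i)) + (\<Sum>i<n. (X * (X * D)) $$ (i, i)) = 0"
  proof -
    have "X * (B * X) + X * (X * D) = X * (B * X + X * D)"
      by (subst mult_add_distrib_mat[of X n n _ n]) auto
    also have "\<dots> = 0\<^sub>m n n"
      unfolding eq by (rule right_mult_zero_mat) (rule X)
    finally have sum0: "X * (B * X) + X * (X * D) = 0\<^sub>m n n" .
    have "(X * (B * X)) $$ (i, i) + (X * (X * D)) $$ (i, i) = 0" if "i < n" for i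
    proof -
      have "(X * (B * X) + X * (X * D)) $$ (i, i) = (X * (B * X)) $$ (i, i) + (X * (X * D)) $$ (i, i)"
        by (rule index_add_mat(1)) (use that carrier_matD[OF X(1)] carrier_matD[OF psd_matD(1)[OF D]] in simp_all)
      then show ?thesis
        unfolding sum0 using that by simp
    qed
    then show ?thesis
      unfolding sum.distrib[symmetric] by (intro sum.neutral) simp
  qed
  ultimately have "(\<Sum>i<n. col X i \<bullet> (B *\<^sub>v col X i)) + (\<Sum>i<n. col X i \<bullet> (D *\<^sub>v col X i)) = 0"
    by (simp add: diag del: index_mult_mat)
  moreover have "0 \<le> (\<Sum>i<n. col X i \<bullet> (D *\<^sub>v col X i))"
    by (intro sum_nonneg psd_matD(3)[OF D]) auto
  moreover have "0 \<le> (\<Sum>i<n. col X i \<bullet> (B *\<^sub>v col X i))"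
    by (intro sum_nonneg psd_matD(3)[OF B(1)]) auto
  ultimately have "(\<Sum>i<n. col X i \<bullet> (B *\<^sub>v col X i)) = 0"
    by linarith
  \<comment> \<open>A vanishing sum of nonnegative values makes every column of \<open>X\<close>
    isotropic for \<open>B\<close>, and \<open>B\<close> is definite.\<close>
  then have "\<forall>i\<in>{..<n}. col X i \<bullet> (B *\<^sub>v col X i) = 0"
    by (subst (asm) sum_nonneg_eq_0_iff) (auto intro!: psd_matD(3)[OF B(1)])
  then have c: "col X i = 0\<^sub>v n" if "i < n" for i
    using psd_mat_definite[OF B, of "col X i"] that by auto
  show ?thesis
  proof (rule eq_matI)
    fix i j assume "i < dim_row (0\<^sub>m n n :: real mat)" "j < dim_col (0\<^sub>m n n :: real mat)"
    then show "X $$ (i, j) = 0\<^sub>m n n $$ (i, j)"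
      using arg_cong[OF c[of j], of "\<lambda>v. v $ i"] carrier_matD[OF X(1)] by simp
  qed (use carrier_matD[OF X(1)] in simp_all)
qed

text \<open>The difference \<open>X = B - D\<close> satisfies
  \<open>B * X + X * D = B * B - D * D = 0\<close>, so uniqueness for the Sylvester equation applies
  even though \<open>B\<close> and \<open>D\<close> are not known to commute.\<close>

lemma psd_mat_square_inj:
  assumes B: "psd_mat n B" and D: "psd_mat n D" "det D \<noteq> 0" and eq: "B * B = D * D"
  shows "B = D"
proof -
  note [simp] = psd_matD(1)[OF B] psd_matD(1)[OF D(1)] square_carrier
  \<comment> \<open>Sylvester uniqueness asks for a nonsingular first matrix; equality of the
    squares transfers nonsingularity from \<open>D\<close> to \<open>B\<close>.\<close>
  have "det B * det B = det D * det D"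
    using arg_cong[OF eq, of det] by (simp add: det_mult[of _ n])
  then have "det B \<noteq> 0"
    using D(2) by auto
  have "B - D = 0\<^sub>m n n"
  proof (rule psd_sylvester_unique[OF B \<open>det B \<noteq> 0\<close> D(1)])
    show "transpose_mat (B - D) = B - D"
      using psd_matD(2)[OF B] psd_matD(2)[OF D(1)] by (simp add: transpose_minus[of _ n n])
    have "B * (B - D) + (B - D) * D = (D * D - B * D) + (B * D - D * D)"
      by (simp add: mult_minus_distrib_mat[of _ n n _ n] minus_mult_distrib_mat[of _ n n _ _ n] eq)
    also have "\<dots> = 0\<^sub>m n n"
      using carrier_matD[OF psd_matD(1)[OF B]] carrier_matD[OF psd_matD(1)[OF D(1)]]
      by (intro eq_matI) (auto simp del: index_mult_mat(1))
    finally show "B * (B - D) + (B - D) * D = 0\<^sub>m n n" .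
  qed (simp add: minus_carrier_mat)
  then have "(B - D) $$ (i, j) = 0" if "i < n" "j < n" for i j
    using that by simp
  then show ?thesis
    using carrier_matD[OF psd_matD(1)[OF B]] carrier_matD[OF psd_matD(1)[OF D(1)]]
    by (intro eq_matI) auto
qed

text \<open>Cancelling the outer factors gives \<open>U * U\<close> as the inverse of
  \<open>M\<close>. Since \<open>sqrt_mat\<close> is a definite description, identifying its value
  with \<open>U\<close> needs the uniqueness of the positive semidefinite root.\<close>

lemma inv_sqrt_mat_eqI:
  assumes U: "psd_mat n U" "det U \<noteq> 0" and M: "M \<in> carrier_mat n n" and eq: "U * M * U = 1\<^sub>m n"
  shows "invertible_mat M" "inv_sqrt_mat M = U"
proof -
  note [simp] = psd_matD(1)[OF U(1)] M square_carrier square_assoc[where n = n]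
  have "(U * M) * U = 1\<^sub>m n"
    by (rule eq)
  then have inv1: "U * (U * M) = 1\<^sub>m n"
    by (intro mat_mult_left_right_inverse[of "U * M" n U]) auto
  then have inv: "(U * U) * M = 1\<^sub>m n"
    by simp
  then have inv': "M * (U * U) = 1\<^sub>m n"
    by (intro mat_mult_left_right_inverse[of "U * U" n M]) auto
  show "invertible_mat M"
    unfolding invertible_mat_def inverts_mat_def using inv inv'
    by (intro conjI exI[of _ "U * U"]) (auto simp: square_mat.simps carrier_matD[OF M] carrier_matD[OF psd_matD(1)[OF U(1)]])
  \<comment> \<open>Being a unit of the matrix ring excludes the value \<open>None\<close> of
    \<open>mat_inverse M\<close>.\<close>
  have "M \<in> Units (ring_mat TYPE(real) n ())"
    unfolding Units_def ring_mat_def using inv inv' by (auto intro!: bexI[of _ "U * U"])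
  then obtain B where B: "mat_inverse M = Some B"
    using mat_inverse(1)[OF M, where b = "()"] by (cases "mat_inverse M") auto
  then have "M * B = 1\<^sub>m n" "B \<in> carrier_mat n n"
    using mat_inverse(2)[OF M] by auto
  then have "B = (U * U) * M * B"
    using inv by simp
  also have "\<dots> = (U * U) * (M * B)"
    using \<open>B \<in> carrier_mat n n\<close> by (intro assoc_mult_mat[of _ n n _ n _ n]) auto
  also have "\<dots> = U * U"
    using \<open>M * B = 1\<^sub>m n\<close> by (simp add: right_mult_one_mat[of _ n n])
  finally have BU: "B = U * U" .
  have "sqrt_mat (U * U) = U"
    unfolding sqrt_mat_def
    using psd_mat_square_inj[OF _ U] U
    by (intro the_equality) (auto simp: carrier_matD[OF psd_matD(1)[OF U(1)]])
  then show "inv_sqrt_mat M = U"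
    by (simp add: inv_sqrt_mat_def B BU)
qed

section \<open>The weight matrix as a sum of rank-one matrices\<close>

lemma weight_mat_carrier [simp]: "weight_mat n m a w \<in> carrier_mat n n"
  by (simp add: weight_mat_def)

lemma weight_mat_symmetric: "transpose_mat (weight_mat n m a w) = weight_mat n m a w"
  by (rule eq_matI) (auto simp: weight_mat_def mult_ac)

lemma weight_mat_mult_vec:
  assumes a: "\<And>j. j < m \<Longrightarrow> a j \<in> carrier_vec n" and v: "v \<in> carrier_vec n" and "k < n"
  shows "(weight_mat n m a w *\<^sub>v v) $ k = (\<Sum>j<m. w $ j * (a j \<bullet> v) * a j $ k)"
proof -
  have "(weight_mat n m a w *\<^sub>v v) $ k = (\<Sum>l<n. \<Sum>j<m. w $ j * (a j $ k * a j $ l) * v $ l)"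
    using assms by (simp add: weight_mat_def scalar_prod_def atLeast0LessThan sum_distrib_right)
  also have "\<dots> = (\<Sum>j<m. \<Sum>l<n. w $ j * (a j $ k * a j $ l) * v $ l)"
    by (rule sum.swap)
  also have "\<dots> = (\<Sum>j<m. w $ j * (a j \<bullet> v) * a j $ k)"
    using v by (intro sum.cong refl)
      (auto simp: scalar_prod_def atLeast0LessThan sum_distrib_left sum_distrib_right mult_ac)
  finally show ?thesis .
qed

text \<open>Multiplying each rank-one term on both sides sends it to the product of
  \<open>B *\<^sub>v a j\<close> with the transpose of \<open>transpose_mat A *\<^sub>v a j\<close>.
  The two outer factors are kept independent because the critical point equation contains both
  \<open>M * (U * U)\<close> and \<open>U * M * U\<close>.\<close>

lemma weight_mat_sandwich:
  assumes a: "\<And>j. j < m \<Longrightarrow> a j \<in> carrier_vec n"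
    and A: "A \<in> carrier_mat n n" and B: "B \<in> carrier_mat n n" and kl: "k < n" "l < n"
  shows "(B * weight_mat n m a w * A) $$ (k, l)
       = (\<Sum>j<m. w $ j * (B *\<^sub>v a j) $ k * (transpose_mat A *\<^sub>v a j) $ l)"
proof -
  have "(B * weight_mat n m a w * A) $$ (k, l) = (B * (weight_mat n m a w * A)) $$ (k, l)"
    using A B by (simp add: square_assoc[where n = n])
  also have "\<dots> = row B k \<bullet> (weight_mat n m a w *\<^sub>v col A l)"
    using A B kl by (simp add: col_mult2[of _ n n _ n])
  also have "\<dots> = (\<Sum>i<n. B $$ (k, i) * (weight_mat n m a w *\<^sub>v col A l) $ i)"
    using A B kl
    by (auto simp: scalar_prod_def atLeast0LessThan weight_mat_def simp del: index_mult_mat_vec intro!: sum.cong)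
  also have "\<dots> = (\<Sum>i<n. \<Sum>j<m. B $$ (k, i) * (w $ j * (a j \<bullet> col A l) * a j $ i))"
    using col_carrier_vec[of l n A n] A kl
    by (intro sum.cong refl)
      (simp add: weight_mat_mult_vec a sum_distrib_left del: index_mult_mat_vec)
  also have "\<dots> = (\<Sum>j<m. \<Sum>i<n. B $$ (k, i) * (w $ j * (a j \<bullet> col A l) * a j $ i))"
    by (rule sum.swap)
  also have "\<dots> = (\<Sum>j<m. w $ j * (B *\<^sub>v a j) $ k * (transpose_mat A *\<^sub>v a j) $ l)"
  proof (intro sum.cong refl)
    fix j assume "j \<in> {..<m}"
    then have aj: "a j \<in> carrier_vec n" using a by auto
    have "(B *\<^sub>v a j) $ k = (\<Sum>i<n. B $$ (k, i) * a j $ i)"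
      using aj B kl by (auto simp: scalar_prod_def atLeast0LessThan)
    moreover have "(transpose_mat A *\<^sub>v a j) $ l = a j \<bullet> col A l"
      using aj A kl by (simp add: comm_scalar_prod[of _ n])
    ultimately show "(\<Sum>i<n. B $$ (k, i) * (w $ j * (a j \<bullet> col A l) * a j $ i))
        = w $ j * (B *\<^sub>v a j) $ k * (transpose_mat A *\<^sub>v a j) $ l"
      by (simp add: sum_distrib_left sum_distrib_right mult_ac)
  qed
  finally show ?thesis .
qed

section \<open>The critical point equation\<close>

text \<open>On the diagonal, adding a multiple of row \<open>k\<close> to itself is a scaling of
  that row. This case alone gives the log determinant a nonzero derivative along the congruence
  paths.\<close>

lemma det_addrow_mat_diag:
  assumes "k < n"
  shows "det (addrow_mat n x k k) = 1 + (x :: 'a :: {idom, ring_1})"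
proof -
  have "addrow_mat n x k k = multrow_mat n k (1 + x)"
    by (rule eq_matI) auto
  then show ?thesis
    using det_multrow_mat[OF assms, of "1 + x"] by simp
qed

lemma addrow_mat_mult_vec:
  assumes "v \<in> carrier_vec n" "k < n" "l < n"
  shows "addrow_mat n x k l *\<^sub>v v = v + (x * v $ l) \<cdot>\<^sub>v unit_vec n k"
proof (rule eq_vecI)
  fix i assume "i < dim_vec (v + (x * v $ l) \<cdot>\<^sub>v unit_vec n k)"
  then have i: "i < n" by simp
  have "(addrow_mat n x k l *\<^sub>v v) $ i
      = (\<Sum>j<n. (if k = i \<and> l = j then (+) x else id) (if i = j then 1 else 0) * v $ j)"
    using assms i by (simp add: scalar_prod_def atLeast0LessThan)
  also have "\<dots> = (\<Sum>j<n. (if k = i \<and> l = j then x * v $ j else 0) + (if i = j then v $ j else 0))"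
    by (intro sum.cong refl) (auto simp: algebra_simps)
  also have "\<dots> = (if k = i then x * v $ l else 0) + v $ i"
    using assms i by (auto simp: sum.distrib)
  finally show "(addrow_mat n x k l *\<^sub>v v) $ i = (v + (x * v $ l) \<cdot>\<^sub>v unit_vec n k) $ i"
    using assms i by (simp add: algebra_simps)
qed (use assms in simp)

lemma transpose_addrow_mat: "transpose_mat (addrow_mat n x k l) = addrow_mat n x l k"
  by (rule eq_matI) auto

text \<open>Moving \<open>U\<close> along congruences stays inside the positive semidefinite matrices for every \<open>x\<close>,
  and the determinant along the path is explicit.\<close>

definition elementary_congruence :: "nat \<Rightarrow> nat \<Rightarrow> nat \<Rightarrow> real mat \<Rightarrow> real \<Rightarrow> real mat" where
  "elementary_congruence n k l U x = addrow_mat n x k l * U * addrow_mat n x l k"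

lemma psd_mat_elementary_congruence: "psd_mat n U \<Longrightarrow> psd_mat n (elementary_congruence n k l U x)"
  using psd_mat_congruence[of n U "addrow_mat n x k l"]
  by (simp add: elementary_congruence_def transpose_addrow_mat)

lemma det_elementary_congruence:
  assumes "U \<in> carrier_mat n n" "k < n" "l < n"
  shows "det (elementary_congruence n k l U x) = (1 + (if k = l then x else 0))\<^sup>2 * det U"
proof -
  have "det (elementary_congruence n k l U x) = det (addrow_mat n x k l) * det U * det (addrow_mat n x l k)"
    using assms by (simp add: elementary_congruence_def det_mult[of _ n] square_carrier)
  then show ?thesis
    using assms det_addrow_mat_diag[of k n x]
    by (auto simp: det_addrow_mat power2_eq_square)
qed

text \<open>The right factor moves \<open>v\<close> by a multiple of the unit vector
  \<open>l\<close>, hence \<open>U *\<^sub>v v\<close> by a multiple of column \<open>l\<close> of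
  \<open>U\<close>; the left factor then adds a multiple of coordinate \<open>l\<close> to
  coordinate \<open>k\<close>.\<close>

lemma elementary_congruence_mult_vec:
  assumes U: "U \<in> carrier_mat n n" and v: "v \<in> carrier_vec n" and "k < n" "l < n" "p < n"
  shows "(elementary_congruence n k l U x *\<^sub>v v) $ p = (U *\<^sub>v v) $ p + x * (v $ k * U $$ (p, l))
      + (if p = k then x * ((U *\<^sub>v v) $ l + x * (v $ k * U $$ (l, l))) else 0)"
proof -
  note [simp] = square_carrier
  define b where "b = v + (x * v $ k) \<cdot>\<^sub>v unit_vec n l"
  have [simp]: "b \<in> carrier_vec n"
    using v by (simp add: b_def)
  have ub: "(U *\<^sub>v b) $ q = (U *\<^sub>v v) $ q + x * (v $ k * U $$ (q, l))" if "q < n" for q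
    using that assms
    by (simp add: b_def scalar_prod_add_distrib[of _ n])
  have "elementary_congruence n k l U x *\<^sub>v v = addrow_mat n x k l *\<^sub>v (U *\<^sub>v (addrow_mat n x l k *\<^sub>v v))"
    using U v by (simp add: elementary_congruence_def square_assoc[where n = n])
  also have "addrow_mat n x l k *\<^sub>v v = b"
    using assms by (simp add: addrow_mat_mult_vec b_def)
  also have "addrow_mat n x k l *\<^sub>v (U *\<^sub>v b) = U *\<^sub>v b + (x * (U *\<^sub>v b) $ l) \<cdot>\<^sub>v unit_vec n k"
    using assms by (intro addrow_mat_mult_vec) simp_all
  also have "\<dots> $ p = (U *\<^sub>v b) $ p + (if p = k then x * (U *\<^sub>v b) $ l else 0)"
    using assms by (simp del: index_mult_mat_vec)
  finally show ?thesis
    using assms by (simp add: ub del: index_mult_mat_vec)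
qed

lemma elementary_congruence_0:
  "U \<in> carrier_mat n n \<Longrightarrow> k < n \<Longrightarrow> l < n \<Longrightarrow> v \<in> carrier_vec n \<Longrightarrow>
    elementary_congruence n k l U 0 *\<^sub>v v = U *\<^sub>v v"
  using elementary_congruence_mult_vec[of U n v k l _ 0]
  by (intro eq_vecI) (simp_all add: elementary_congruence_def[of n k l U 0] carrier_matD del: index_mult_mat_vec)

lemma DERIV_sqrt_pos:
  assumes "(h has_real_derivative d) (at x)" "h x = y" "0 < y"
  shows "((\<lambda>x. sqrt (h x)) has_real_derivative inverse (sqrt y) / 2 * d) (at x)"
proof (rule DERIV_chain'[where f = h and g = sqrt])
  show "(sqrt has_real_derivative inverse (sqrt y) / 2) (at (h x))"
    unfolding assms(2) by (rule DERIV_real_sqrt) (rule assms(3))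
qed (rule assms(1))

text \<open>To first order, \<open>q = U *\<^sub>v v\<close> moves by \<open>v $ k\<close> times
  column \<open>l\<close> of \<open>U\<close> plus \<open>q $ l\<close> times the unit vector
  \<open>k\<close>. Pairing this with \<open>q\<close> and using the symmetry of \<open>U\<close>
  gives the numerator.\<close>

lemma has_derivative_norm2_elementary_congruence:
  assumes U: "psd_mat n U" and v: "v \<in> carrier_vec n" and kl: "k < n" "l < n"
    and ne: "U *\<^sub>v v \<noteq> 0\<^sub>v n"
  shows "((\<lambda>x. norm2 (elementary_congruence n k l U x *\<^sub>v v)) has_real_derivative
      (v $ k * ((U * U) *\<^sub>v v) $ l + (U *\<^sub>v v) $ k * (U *\<^sub>v v) $ l) / norm2 (U *\<^sub>v v)) (at 0)"
proof -
  note [simp] = square_carrier psd_matD(1)[OF U] v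
  define q where "q = U *\<^sub>v v"
  have q: "q \<in> carrier_vec n" "q \<noteq> 0\<^sub>v n"
    using ne by (simp_all add: q_def)
  define h where "h x p = q $ p + x * (v $ k * U $$ (p, l))
      + (if p = k then x * (q $ l + x * (v $ k * U $$ (l, l))) else 0)" for x p
  have n: "norm2 (elementary_congruence n k l U x *\<^sub>v v) = sqrt (\<Sum>p<n. h x p * h x p)" for x
    using kl psd_mat_elementary_congruence[OF U, of k l x, THEN psd_matD(1)] elementary_congruence_mult_vec[OF psd_matD(1)[OF U] v kl]
    by (auto simp: norm2_def scalar_prod_def atLeast0LessThan h_def q_def
        simp del: index_mult_mat_vec intro!: sum.cong)
  have h': "((\<lambda>x. h x p) has_real_derivative (v $ k * U $$ (p, l) + (if p = k then q $ l else 0))) (at 0)" for p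
    unfolding h_def by (auto intro!: derivative_eq_intros)
  have h0: "h 0 p = q $ p" for p
    by (simp add: h_def)
  have sum_eq: "(\<Sum>p<n. 2 * q $ p * (v $ k * U $$ (p, l) + (if p = k then q $ l else 0)))
      = 2 * (v $ k * ((U * U) *\<^sub>v v) $ l + q $ k * q $ l)"
  proof -
    have s: "U $$ (p, l) = U $$ (l, p)" if "p < n" for p
      using arg_cong[OF psd_matD(2)[OF U], of "\<lambda>A. A $$ (p, l)"] that kl
        carrier_matD[OF psd_matD(1)[OF U]] by simp
    have "(U * U) *\<^sub>v v = U *\<^sub>v q"
      by (simp add: q_def square_assoc[where n = n])
    then have "((U * U) *\<^sub>v v) $ l = (\<Sum>p<n. U $$ (l, p) * q $ p)"
      using kl q carrier_matD[OF psd_matD(1)[OF U]]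
      by (simp add: scalar_prod_def atLeast0LessThan)
    moreover have "(\<Sum>p<n. 2 * q $ p * (v $ k * U $$ (p, l) + (if p = k then q $ l else 0)))
       = (\<Sum>p<n. 2 * v $ k * (U $$ (l, p) * q $ p) + (if p = k then 2 * q $ k * q $ l else 0))"
      by (intro sum.cong) (auto simp: s algebra_simps)
    ultimately show ?thesis
      using kl by (simp add: sum.distrib sum_distrib_left algebra_simps)
  qed
  have D1: "((\<lambda>x. \<Sum>p<n. h x p * h x p) has_real_derivative
      (\<Sum>p<n. 2 * q $ p * (v $ k * U $$ (p, l) + (if p = k then q $ l else 0)))) (at 0)"
    by (auto intro!: derivative_eq_intros h' simp: h0 mult.assoc)
  have q0: "(\<Sum>p<n. h 0 p * h 0 p) = q \<bullet> q"
    using q by (simp add: h0 scalar_prod_def atLeast0LessThan)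
  have "0 < q \<bullet> q"
    using q scalar_prod_self_nonneg[of q] scalar_prod_self_eq_0_iff[of q n] by linarith
  then have D: "((\<lambda>x. sqrt (\<Sum>p<n. h x p * h x p)) has_real_derivative
      inverse (sqrt (q \<bullet> q)) / 2
        * (\<Sum>p<n. 2 * q $ p * (v $ k * U $$ (p, l) + (if p = k then q $ l else 0)))) (at 0)"
    by (rule DERIV_sqrt_pos[OF D1, OF q0])
  have cancel: "inverse r / 2 * (2 * z) = z / r" for r z :: real
    by (cases "r = 0") (simp_all add: field_simps)
  show ?thesis
    unfolding n
  proof (rule DERIV_cong[OF D])
    show "inverse (sqrt (q \<bullet> q)) / 2
        * (\<Sum>p<n. 2 * q $ p * (v $ k * U $$ (p, l) + (if p = k then q $ l else 0)))
      = (v $ k * ((U * U) *\<^sub>v v) $ l + (U *\<^sub>v v) $ k * (U *\<^sub>v v) $ l) / norm2 (U *\<^sub>v v)"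
      unfolding sum_eq cancel by (simp only: norm2_def q_def)
  qed
qed

definition log_det_potential :: "nat \<Rightarrow> (nat \<Rightarrow> real \<Rightarrow> real) \<Rightarrow> (nat \<Rightarrow> real vec) \<Rightarrow> real mat \<Rightarrow> real" where
  "log_det_potential m G a U = ln \<bar>det U\<bar> - (\<Sum>i<m. G i (norm2 (U *\<^sub>v a i)))"

text \<open>Every congruence path has its local maximum at parameter 0. The vanishing derivatives
  over all \<open>k\<close> and \<open>l\<close> are the entries of
  \<open>M * (U * U) + U * M * U = 2 I\<close>, where \<open>M\<close> is the weight matrix.
  Congruences keep the competitors positive semidefinite, at the price of an equation that is not
  visibly symmetric.\<close>

lemma maximizer_sandwich:
  assumes U: "psd_mat n U" "det U \<noteq> 0"
    and a: "\<And>i. i < m \<Longrightarrow> a i \<in> carrier_vec n \<and> a i \<noteq> 0\<^sub>v n"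
    and G: "\<And>i t. i < m \<Longrightarrow> 0 < t \<Longrightarrow> (G i has_real_derivative g i t / t) (at t)"
    and max: "\<And>V. psd_mat n V \<Longrightarrow> det V \<noteq> 0 \<Longrightarrow> log_det_potential m G a V \<le> log_det_potential m G a U"
  defines "w \<equiv> vec m (\<lambda>i. g i (norm2 (U *\<^sub>v a i)) / (norm2 (U *\<^sub>v a i))\<^sup>2)"
  shows "U * weight_mat n m a w * U = 1\<^sub>m n"
proof -
  note [simp] = square_carrier psd_matD(1)[OF U(1)] square_assoc[where n = n]
  define M where "M = weight_mat n m a w"
  have [simp]: "M \<in> carrier_mat n n"
    by (simp add: M_def)
  have Ua: "U *\<^sub>v a i \<noteq> 0\<^sub>v n" if "i < m" for i
    using det_0_iff_vec_prod_zero_field[OF psd_matD(1)[OF U(1)]] U(2) a[OF that] by blast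
  have crit: "(M * (U * U)) $$ (k, l) + (U * M * U) $$ (k, l) = 2 * (1\<^sub>m n) $$ (k, l)"
    if kl: "k < n" "l < n" for k l
  proof -
    define J where "J x = log_det_potential m G a (elementary_congruence n k l U x)" for x
    define \<delta> :: real where "\<delta> = (if k = l then 1 else 0)"
    define r where "r i = a i $ k * ((U * U) *\<^sub>v a i) $ l + (U *\<^sub>v a i) $ k * (U *\<^sub>v a i) $ l" for i
    have det: "det (elementary_congruence n k l U x) = (1 + \<delta> * x)\<^sup>2 * det U" for x
      using det_elementary_congruence[OF psd_matD(1)[OF U(1)] kl] by (simp add: \<delta>_def)
    have "((\<lambda>x. ln \<bar>det (elementary_congruence n k l U x)\<bar>) has_real_derivative 2 * \<delta>) (at 0)"
    proof -
      have "((\<lambda>x. ln ((1 + \<delta> * x)\<^sup>2 * \<bar>det U\<bar>)) has_real_derivative 2 * \<delta>) (at 0)"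
        using U(2) by (auto intro!: derivative_eq_intros)
      then show ?thesis
        by (simp add: det abs_mult)
    qed
    moreover have "((\<lambda>x. G i (norm2 (elementary_congruence n k l U x *\<^sub>v a i))) has_real_derivative
        w $ i * r i) (at 0)" if i: "i < m" for i
    proof -
      have ai: "a i \<in> carrier_vec n" using a[OF i] by blast
      \<comment> \<open>One division by the norm comes from \<open>G i\<close> having derivative
        \<open>g i t / t\<close>, the other from differentiating the norm. Together they produce the
        weight \<open>w $ i\<close>.\<close>
      have "((\<lambda>x. G i (norm2 (elementary_congruence n k l U x *\<^sub>v a i))) has_real_derivative
          g i (norm2 (U *\<^sub>v a i)) / norm2 (U *\<^sub>v a i) * (r i / norm2 (U *\<^sub>v a i))) (at 0)"
      proof (rule DERIV_chain'[where g = "G i"])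
        show "(G i has_real_derivative g i (norm2 (U *\<^sub>v a i)) / norm2 (U *\<^sub>v a i))
            (at (norm2 (elementary_congruence n k l U 0 *\<^sub>v a i)))"
          using G[OF i norm2_pos[OF _ Ua[OF i]]] ai by (simp add: elementary_congruence_0 kl)
      qed (use has_derivative_norm2_elementary_congruence[OF U(1) ai kl Ua[OF i]] in \<open>simp add: r_def\<close>)
      then show ?thesis
        using i by (simp add: w_def power2_eq_square mult_ac)
    qed
    ultimately have "(J has_real_derivative 2 * \<delta> - (\<Sum>i<m. w $ i * r i)) (at 0)"
      unfolding J_def log_det_potential_def by (intro DERIV_diff DERIV_sum) auto
    \<comment> \<open>For parameters of absolute value below 1, the factor
      \<open>1 + \<delta> * x\<close> is nonzero, so the path stays among the invertible
      competitors.\<close>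
    moreover have "J x \<le> J 0" if "\<bar>0 - x\<bar> < 1" for x
    proof -
      have "det (elementary_congruence n k l U x) \<noteq> 0"
        using that U(2) by (auto simp: det \<delta>_def)
      then have "J x \<le> log_det_potential m G a U"
        unfolding J_def using U by (intro max psd_mat_elementary_congruence)
      moreover have "J 0 = log_det_potential m G a U"
        using a kl by (simp add: J_def log_det_potential_def det elementary_congruence_0)
      ultimately show ?thesis by simp
    qed
    ultimately have "2 * \<delta> - (\<Sum>i<m. w $ i * r i) = 0"
      by (intro DERIV_local_max[of J _ 0 1]) auto
    moreover have "(M * (U * U)) $$ (k, l) = (\<Sum>i<m. w $ i * a i $ k * ((U * U) *\<^sub>v a i) $ l)"
    proof -
      have "(M * (U * U)) $$ (k, l) = (1\<^sub>m n * weight_mat n m a w * (U * U)) $$ (k, l)"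
        by (simp add: M_def left_mult_one_mat[of _ n n])
      also have "\<dots> = (\<Sum>i<m. w $ i * (1\<^sub>m n *\<^sub>v a i) $ k * (transpose_mat (U * U) *\<^sub>v a i) $ l)"
        using a kl by (intro weight_mat_sandwich) auto
      also have "transpose_mat (U * U) = U * U"
        using psd_matD(2)[OF U(1)] by (simp add: transpose_mult[of _ n n _ n])
      finally show ?thesis
        using a by (simp add: one_mult_mat_vec[of _ n] del: index_mult_mat_vec)
    qed
    moreover have "(U * M * U) $$ (k, l) = (\<Sum>i<m. w $ i * (U *\<^sub>v a i) $ k * (U *\<^sub>v a i) $ l)"
      using weight_mat_sandwich[of m a n U U k l w] a kl psd_matD(2)[OF U(1)] by (simp add: M_def)
    moreover have "(\<Sum>i<m. w $ i * r i) = (\<Sum>i<m. w $ i * a i $ k * ((U * U) *\<^sub>v a i) $ l)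
        + (\<Sum>i<m. w $ i * (U *\<^sub>v a i) $ k * (U *\<^sub>v a i) $ l)"
      by (simp only: r_def distrib_left sum.distrib mult.assoc)
    moreover have "1\<^sub>m n $$ (k, l) = \<delta>"
      using kl by (simp add: \<delta>_def)
    ultimately show ?thesis
      by linarith
  qed
  define X where "X = U * M * U"
  have [simp]: "X \<in> carrier_mat n n"
    by (simp add: X_def)
  have Xt: "transpose_mat X = X"
    using psd_matD(2)[OF U(1)] weight_mat_symmetric[of n m a w]
    by (simp add: X_def M_def transpose_mult[of _ n n _ n])
  have crit_mat: "M * (U * U) + X = 2 \<cdot>\<^sub>m 1\<^sub>m n"
    using crit carrier_matD[OF psd_matD(1)[OF U(1)]] carrier_matD[of M n n]
    by (intro eq_matI) (auto simp: X_def simp del: index_mult_mat(1))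
  \<comment> \<open>Symmetrising the critical point equation gives a Sylvester equation with solution \<open>X = I\<close>.\<close>
  have "X * U + U * X = U * (M * (U * U) + X)"
    by (simp add: X_def mult_add_distrib_mat[of _ n n _ n])
  also have "\<dots> = 2 \<cdot>\<^sub>m U"
    by (simp add: crit_mat mult_smult_distrib[of _ n n _ n] right_mult_one_mat[of _ n n])
  finally have XU: "X * U + U * X = 2 \<cdot>\<^sub>m U" .
  have "X - 1\<^sub>m n = 0\<^sub>m n n"
  proof (rule psd_sylvester_unique[OF U U(1)])
    show "transpose_mat (X - 1\<^sub>m n) = X - 1\<^sub>m n"
      using Xt by (simp add: transpose_minus[of _ n n])
    have "U * (X - 1\<^sub>m n) + (X - 1\<^sub>m n) * U = (U * X - U) + (X * U - U)"
      by (simp add: mult_minus_distrib_mat[of _ n n _ n] minus_mult_distrib_mat[of _ n n _ _ n]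
          right_mult_one_mat[of _ n n] left_mult_one_mat[of _ n n])
    also have "\<dots> = (X * U + U * X) - 2 \<cdot>\<^sub>m U"
      using carrier_matD[OF psd_matD(1)[OF U(1)]] carrier_matD[of X n n]
      by (intro eq_matI) (auto simp del: index_mult_mat(1))
    also have "\<dots> = 0\<^sub>m n n"
      unfolding XU using carrier_matD[OF psd_matD(1)[OF U(1)]] by (intro eq_matI) auto
    finally show "U * (X - 1\<^sub>m n) + (X - 1\<^sub>m n) * U = 0\<^sub>m n n" .
  qed (simp add: minus_carrier_mat)
  then have "(X - 1\<^sub>m n) $$ (i, j) = 0" if "i < n" "j < n" for i j
    using that by simp
  then show ?thesis
    using carrier_matD[of X n n] unfolding M_def[symmetric] X_def[symmetric]
    by (intro eq_matI) auto
qed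

section \<open>Existence of a maximiser\<close>

text \<open>The vectors \<open>v\<close> that admit such a bound form a submodule containing every
  \<open>a i\<close>, hence the whole span. This avoids choosing coefficients of a linear
  combination.\<close>

lemma span_scalar_prod_bound:
  fixes a :: "nat \<Rightarrow> real vec"
  assumes a: "\<And>i. i < m \<Longrightarrow> a i \<in> carrier_vec n" and v: "v \<in> vec_span n (a ` {..<m})"
  shows "\<exists>b\<ge>0. \<forall>r\<in>carrier_vec n. \<bar>r \<bullet> v\<bar> \<le> b * (\<Sum>i<m. \<bar>r \<bullet> a i\<bar>)"
proof -
  define P where "P v b \<longleftrightarrow> 0 \<le> b \<and> (\<forall>r\<in>carrier_vec n. \<bar>r \<bullet> v\<bar> \<le> b * (\<Sum>i<m. \<bar>r \<bullet> a i\<bar>))"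
    for v b
  define N where "N = {v \<in> carrier_vec n. \<exists>b. P v b}"
  have add: "P (v + w) (b + b')" if "P v b" "P w b'" "v \<in> carrier_vec n" "w \<in> carrier_vec n" for v w b b'
    unfolding P_def
  proof (intro conjI ballI)
    fix r :: "real vec" assume r: "r \<in> carrier_vec n"
    have "\<bar>r \<bullet> (v + w)\<bar> \<le> \<bar>r \<bullet> v\<bar> + \<bar>r \<bullet> w\<bar>"
      using that r by (simp add: scalar_prod_add_distrib[of _ n])
    also have "\<dots> \<le> b * (\<Sum>i<m. \<bar>r \<bullet> a i\<bar>) + b' * (\<Sum>i<m. \<bar>r \<bullet> a i\<bar>)"
      using that r by (intro add_mono) (auto simp: P_def)
    finally show "\<bar>r \<bullet> (v + w)\<bar> \<le> (b + b') * (\<Sum>i<m. \<bar>r \<bullet> a i\<bar>)"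
      by (simp add: distrib_right)
  qed (use that in \<open>auto simp: P_def\<close>)
  have smult: "P (x \<cdot>\<^sub>v v) (\<bar>x\<bar> * b)" if "P v b" "v \<in> carrier_vec n" for v x b
    using that by (auto simp: P_def scalar_prod_smult_distrib[of _ n] abs_mult mult.assoc mult_left_mono)
  have "LinearCombinations.submodule class_ring N (module_vec TYPE(real) n)"
  proof (rule submodule.intro[OF vec_module])
    show "N \<subseteq> carrier (module_vec TYPE(real) n)"
      by (auto simp: N_def module_vec_simps)
    show "v \<oplus>\<^bsub>module_vec TYPE(real) n\<^esub> w \<in> N" if "v \<in> N" "w \<in> N" for v w
      using that add by (fastforce simp: N_def module_vec_simps)
    have "P (0\<^sub>v n) 0"
      by (simp add: P_def)
    then show "\<zero>\<^bsub>module_vec TYPE(real) n\<^esub> \<in> N"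
      by (auto simp: N_def module_vec_simps)
    show "x \<odot>\<^bsub>module_vec TYPE(real) n\<^esub> v \<in> N" if "v \<in> N" for x v
      using that smult by (fastforce simp: N_def module_vec_simps)
  qed
  moreover have "a ` {..<m} \<subseteq> N"
  proof (rule image_subsetI)
    fix i assume "i \<in> {..<m}"
    then have "P (a i) 1"
      by (auto simp: P_def intro!: member_le_sum)
    then show "a i \<in> N"
      using a \<open>i \<in> {..<m}\<close> by (auto simp: N_def)
  qed
  ultimately have "vec_span n (a ` {..<m}) \<subseteq> N"
    by (intro module.span_is_subset[OF vec_module])
  then show ?thesis
    using v by (auto simp: N_def P_def)
qed

text \<open>An entry is the scalar product of a row of \<open>U\<close> with a unit vector, and a
  row paired with \<open>a i\<close> is a coordinate of \<open>U *\<^sub>v a i\<close>. The constant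
  \<open>b\<close> is independent of \<open>U\<close>, so the norms control the whole
  matrix.\<close>

lemma spanning_entry_bound:
  fixes a :: "nat \<Rightarrow> real vec"
  assumes a: "\<And>i. i < m \<Longrightarrow> a i \<in> carrier_vec n" and span: "vec_span n (a ` {..<m}) = carrier_vec n"
  obtains b where "1 \<le> b"
    "\<And>U k l. \<lbrakk>U \<in> carrier_mat n n; k < n; l < n\<rbrakk> \<Longrightarrow> \<bar>U $$ (k, l)\<bar> \<le> b * (\<Sum>i<m. norm2 (U *\<^sub>v a i))"
proof -
  have "\<exists>b\<ge>0. \<forall>r\<in>carrier_vec n. \<bar>r \<bullet> unit_vec n l\<bar> \<le> b * (\<Sum>i<m. \<bar>r \<bullet> a i\<bar>)" for l
    using a by (intro span_scalar_prod_bound) (auto simp: span)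
  then obtain b where b: "0 \<le> b l"
    "r \<in> carrier_vec n \<Longrightarrow> \<bar>r \<bullet> unit_vec n l\<bar> \<le> b l * (\<Sum>i<m. \<bar>r \<bullet> a i\<bar>)" for l r
    by metis
  show ?thesis
  proof
    \<comment> \<open>The sum serves all columns at once; the added 1 keeps the constant positive
      for \<open>n = 0\<close> too, so that its logarithm can be taken.\<close>
    show "1 \<le> 1 + (\<Sum>l<n. b l)"
      by (simp add: sum_nonneg b)
    fix U :: "real mat" and k l assume U: "U \<in> carrier_mat n n" and kl: "k < n" "l < n"
    have "\<bar>U $$ (k, l)\<bar> = \<bar>row U k \<bullet> unit_vec n l\<bar>"
      using U kl by simp
    also have "\<dots> \<le> b l * (\<Sum>i<m. \<bar>row U k \<bullet> a i\<bar>)"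
      using U kl by (intro b) auto
    also have "\<dots> \<le> (1 + (\<Sum>l<n. b l)) * (\<Sum>i<m. norm2 (U *\<^sub>v a i))"
    proof (rule mult_mono)
      have "b l \<le> (\<Sum>l<n. b l)"
        using kl b by (intro member_le_sum) auto
      then show "b l \<le> 1 + (\<Sum>l<n. b l)" by simp
      show "(\<Sum>i<m. \<bar>row U k \<bullet> a i\<bar>) \<le> (\<Sum>i<m. norm2 (U *\<^sub>v a i))"
        using U kl abs_index_le_norm2[of k "U *\<^sub>v a _"] by (intro sum_mono) auto
    qed (auto intro!: sum_nonneg add_nonneg_nonneg b)
    finally show "\<bar>U $$ (k, l)\<bar> \<le> (1 + (\<Sum>l<n. b l)) * (\<Sum>i<m. norm2 (U *\<^sub>v a i))" .
  qed
qed

text \<open>The Leibniz expansion has \<open>fact n\<close> terms. What matters is the polynomial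
  growth in \<open>r\<close>, which makes the log determinant grow only logarithmically.\<close>

lemma abs_det_le:
  assumes "A \<in> carrier_mat n n" "\<And>i j. i < n \<Longrightarrow> j < n \<Longrightarrow> \<bar>A $$ (i, j)\<bar> \<le> (r :: real)"
  shows "\<bar>det A\<bar> \<le> fact n * r ^ n"
proof -
  have "\<bar>det A\<bar> \<le> (\<Sum>p | p permutes {0..<n}. \<bar>of_int (sign p) * (\<Prod>i = 0..<n. A $$ (i, p i))\<bar>)"
    unfolding det_def'[OF assms(1)] by (rule sum_abs)
  also have "\<dots> \<le> (\<Sum>p | p permutes {0..<n}. r ^ n)"
  proof (intro sum_mono)
    fix p assume "p \<in> {p. p permutes {0..<n}}"
    then have p: "p i < n" if "i < n" for i
      using that permutes_in_image[of p "{0..<n}" i] by auto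
    have "\<bar>of_int (sign p) * (\<Prod>i = 0..<n. A $$ (i, p i))\<bar> = (\<Prod>i = 0..<n. \<bar>A $$ (i, p i)\<bar>)"
      by (simp add: abs_mult abs_prod sign_def)
    also have "\<dots> \<le> (\<Prod>i = 0..<n. r)"
      using p assms by (intro prod_mono) auto
    finally show "\<bar>of_int (sign p) * (\<Prod>i = 0..<n. A $$ (i, p i))\<bar> \<le> r ^ n"
      by simp
  qed
  also have "\<dots> = fact n * r ^ n"
    by (simp add: card_permutations[of _ n])
  finally show ?thesis .
qed

section \<open>Continuity and compactness through entry functions\<close>

lemma continuous_on_det_mat: "continuous_on S (\<lambda>h :: nat \<times> nat \<Rightarrow> real. det (mat n n h))"
proof -
  have "det (mat n n h) = (\<Sum>p | p permutes {0..<n}. of_int (sign p) * (\<Prod>i = 0..<n. h (i, p i)))" for h :: "nat \<times> nat \<Rightarrow> real"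
    unfolding det_def'[OF mat_carrier]
    by (intro sum.cong refl arg_cong2[of _ _ _ _ "(*)"] prod.cong)
      (auto dest: permutes_in_image[of _ _ "_ :: nat"])
  then show ?thesis
    by (auto intro!: continuous_intros continuous_on_subset[OF continuous_on_product_coordinates])
qed

lemma continuous_on_mat_mult_vec:
  assumes "k < n" "v \<in> carrier_vec n"
  shows "continuous_on S (\<lambda>h :: nat \<times> nat \<Rightarrow> real. (mat n n h *\<^sub>v v) $ k)"
proof -
  have "(mat n n h *\<^sub>v v) $ k = (\<Sum>l<n. h (k, l) * v $ l)" for h
    using assms by (simp add: scalar_prod_def atLeast0LessThan)
  then show ?thesis
    by (auto intro!: continuous_intros continuous_on_subset[OF continuous_on_product_coordinates])
qed

lemma continuous_on_scalar_prod_mat_mult_vec: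
  assumes "v \<in> carrier_vec n"
  shows "continuous_on S (\<lambda>h :: nat \<times> nat \<Rightarrow> real. v \<bullet> (mat n n h *\<^sub>v v))"
proof -
  have "v \<bullet> (mat n n h *\<^sub>v v) = (\<Sum>k<n. v $ k * (mat n n h *\<^sub>v v) $ k)" for h
    by (simp add: scalar_prod_def[of v] atLeast0LessThan del: index_mult_mat_vec)
  then show ?thesis
    using assms by (auto intro!: continuous_intros continuous_on_mat_mult_vec simp del: index_mult_mat_vec)
qed

lemma continuous_on_norm2_mat_mult_vec:
  assumes "v \<in> carrier_vec n"
  shows "continuous_on S (\<lambda>h :: nat \<times> nat \<Rightarrow> real. norm2 (mat n n h *\<^sub>v v))"
proof -
  have "norm2 (mat n n h *\<^sub>v v) = sqrt (\<Sum>k<n. (mat n n h *\<^sub>v v) $ k * (mat n n h *\<^sub>v v) $ k)" for h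
    by (simp add: norm2_def scalar_prod_def[of "mat n n h *\<^sub>v v"] atLeast0LessThan del: index_mult_mat_vec)
  then show ?thesis
    using assms by (auto intro!: continuous_intros continuous_on_mat_mult_vec simp del: index_mult_mat_vec)
qed

text \<open>This is Tychonoff's theorem for a product of intervals. An entry function lives on all
  index pairs, and \<open>mat n n\<close> reads only finitely many of its values.\<close>

lemma compact_cube: "compact {h :: 'a \<Rightarrow> real. \<forall>x. \<bar>h x\<bar> \<le> r}"
proof -
  have "compactin (product_topology (\<lambda>_. euclidean) UNIV) (Pi\<^sub>E (UNIV :: 'a set) (\<lambda>_. {-r..r}))"
    by (simp add: compactin_PiE)
  moreover have "Pi\<^sub>E (UNIV :: 'a set) (\<lambda>_. {-r..r}) = {h. \<forall>x. \<bar>h x\<bar> \<le> r}"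
    by (auto simp: PiE_def Pi_def abs_le_iff minus_le_iff)
  ultimately show ?thesis
    by (simp add: euclidean_product_topology)
qed

lemma closed_psd_mat: "closed {h. psd_mat n (mat n n h)}"
proof -
  have "{h :: nat \<times> nat \<Rightarrow> real. psd_mat n (mat n n h)}
      = (\<Inter>k\<in>{..<n}. \<Inter>l\<in>{..<n}. {h. h (k, l) = h (l, k)})
        \<inter> (\<Inter>v\<in>carrier_vec n. {h. 0 \<le> v \<bullet> (mat n n h *\<^sub>v v)})"
    by (auto simp: psd_mat_def mat_eq_iff)
  also have "closed \<dots>"
    by (intro closed_Int closed_INT ballI closed_Collect_eq closed_Collect_le continuous_on_const
        continuous_on_product_coordinates continuous_on_scalar_prod_mat_mult_vec)
  finally show ?thesis .
qed

text \<open>Since every \<open>G i\<close> is at least \<open>- K\<close>, a potential of at least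
  \<open>J\<close> keeps the determinant away from 0. Since the sum of the \<open>G i\<close> grows
  like a power of the total norm \<open>T\<close> while the log determinant grows at most
  logarithmically in \<open>T\<close>, it also bounds \<open>T\<close> and hence the
  entries.\<close>

lemma log_det_potential_superlevel:
  fixes a :: "nat \<Rightarrow> real vec"
  assumes a: "\<And>i. i < m \<Longrightarrow> a i \<in> carrier_vec n \<and> a i \<noteq> 0\<^sub>v n"
    and span: "vec_span n (a ` {..<m}) = carrier_vec n"
    and pos: "0 < \<theta>" "0 < \<epsilon>"
    and G: "\<And>i t. i < m \<Longrightarrow> 0 < t \<Longrightarrow> \<epsilon> * t powr \<theta> - K \<le> G i t"
  shows "\<exists>R. \<exists>\<delta>>0. \<forall>U\<in>carrier_mat n n. det U \<noteq> 0 \<longrightarrow> J \<le> log_det_potential m G a U \<longrightarrow>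
      (\<forall>k<n. \<forall>l<n. \<bar>U $$ (k, l)\<bar> \<le> R) \<and> \<delta> \<le> \<bar>det U\<bar>"
proof -
  obtain b where b: "1 \<le> b"
    "\<And>U k l. \<lbrakk>U \<in> carrier_mat n n; k < n; l < n\<rbrakk> \<Longrightarrow> \<bar>U $$ (k, l)\<bar> \<le> b * (\<Sum>i<m. norm2 (U *\<^sub>v a i))"
    using spanning_entry_bound[of m a n] a span by blast
  have "\<forall>\<^sub>F x in at_top. ln (fact n) + n * ln b + n * ln (1 + x)
      - (\<epsilon> * (x / (m + 1)) powr \<theta> - m * K) < J"
    using pos by real_asymp
  \<comment> \<open>Beyond \<open>x0\<close> the power with exponent \<theta> outweighs the
    logarithm.\<close>
  then obtain x0 where x0: "x0 \<le> x \<Longrightarrow> ln (fact n) + n * ln b + n * ln (1 + x)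
      - (\<epsilon> * (x / (m + 1)) powr \<theta> - m * K) < J" for x
    by (auto simp: eventually_at_top_linorder)
  have t: "0 < norm2 (U *\<^sub>v a i)" if "U \<in> carrier_mat n n" "det U \<noteq> 0" "i < m" for U i
    using det_0_iff_vec_prod_zero_field[OF that(1)] that a[OF that(3)]
    by (intro norm2_pos[of _ n]) (auto simp: square_carrier)
  show ?thesis
  proof (rule exI[of _ "b * x0"], rule exI[of _ "exp (J - m * K)"], intro conjI ballI impI allI)
    show "0 < exp (J - m * K)" by simp
  next
    fix U :: "real mat" assume U: "U \<in> carrier_mat n n" "det U \<noteq> 0" and J: "J \<le> log_det_potential m G a U"
    define T where "T = (\<Sum>i<m. norm2 (U *\<^sub>v a i))"
    have T: "0 \<le> T"
      unfolding T_def by (intro sum_nonneg norm2_nonneg)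
    have "(\<Sum>i<m. - K) \<le> (\<Sum>i<m. G i (norm2 (U *\<^sub>v a i)))"
    proof (intro sum_mono)
      fix i assume "i \<in> {..<m}"
      then have "\<epsilon> * norm2 (U *\<^sub>v a i) powr \<theta> - K \<le> G i (norm2 (U *\<^sub>v a i))"
        using t[OF U] by (intro G) auto
      moreover have "0 \<le> \<epsilon> * norm2 (U *\<^sub>v a i) powr \<theta>"
        using pos by simp
      ultimately show "- K \<le> G i (norm2 (U *\<^sub>v a i))" by linarith
    qed
    then have "J - m * K \<le> ln \<bar>det U\<bar>"
      using J by (simp add: log_det_potential_def)
    then show "exp (J - m * K) \<le> \<bar>det U\<bar>"
      using U by (metis exp_le_cancel_iff exp_ln zero_less_abs_iff)
    have Gsum: "\<epsilon> * (T / (m + 1)) powr \<theta> - m * K \<le> (\<Sum>i<m. G i (norm2 (U *\<^sub>v a i)))"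
    proof -
      have "(T / (m + 1)) powr \<theta> \<le> (\<Sum>i<m. norm2 (U *\<^sub>v a i) powr \<theta>)"
      proof (cases "T = 0")
        case False
        \<comment> \<open>Pigeonhole: \<open>m\<close> summands all below \<open>T / (m + 1)\<close>
          could not add up to \<open>T > 0\<close>. The denominator \<open>m + 1\<close> is nonzero
          for every \<open>m\<close>.\<close>
        have "\<exists>i<m. T / (m + 1) \<le> norm2 (U *\<^sub>v a i)"
        proof (rule ccontr)
          assume "\<not> ?thesis"
          then have "T \<le> (\<Sum>i<m. T / (m + 1))"
            unfolding T_def[symmetric] by (subst T_def, intro sum_mono) (auto simp: not_le)
          also have "\<dots> = T * (m / (m + 1))"
            by simp
          also have "\<dots> < T * 1"
            using T False by (intro mult_strict_left_mono) auto
          finally show False by simp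
        qed
        then obtain i where i: "i < m" "T / (m + 1) \<le> norm2 (U *\<^sub>v a i)"
          by blast
        have "(T / (m + 1)) powr \<theta> \<le> norm2 (U *\<^sub>v a i) powr \<theta>"
          using i T pos by (intro powr_mono2) auto
        also have "\<dots> \<le> (\<Sum>i<m. norm2 (U *\<^sub>v a i) powr \<theta>)"
          using i by (intro member_le_sum) auto
        finally show ?thesis .
      qed (simp add: sum_nonneg)
      then have "\<epsilon> * (T / (m + 1)) powr \<theta> \<le> (\<Sum>i<m. \<epsilon> * norm2 (U *\<^sub>v a i) powr \<theta>)"
        using pos by (simp flip: sum_distrib_left)
      moreover have "(\<Sum>i<m. \<epsilon> * norm2 (U *\<^sub>v a i) powr \<theta> - K) \<le> (\<Sum>i<m. G i (norm2 (U *\<^sub>v a i)))"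
        using t[OF U] by (intro sum_mono G) auto
      ultimately show ?thesis
        by (simp add: sum_subtractf)
    qed
    have "\<bar>U $$ (k, l)\<bar> \<le> b * (1 + T)" if "k < n" "l < n" for k l
      using b(2)[OF U(1) that] b(1) unfolding T_def by (simp add: distrib_left)
    then have "\<bar>det U\<bar> \<le> fact n * (b * (1 + T)) ^ n"
      by (intro abs_det_le U)
    then have "ln \<bar>det U\<bar> \<le> ln (fact n * (b * (1 + T)) ^ n)"
      using U b T by (subst ln_le_cancel_iff) auto
    also have "\<dots> = ln (fact n) + n * ln (b * (1 + T))"
      using b(1) T by (subst ln_mult) (auto simp: ln_realpow)
    also have "ln (b * (1 + T)) = ln b + ln (1 + T)"
      using b(1) T by (subst ln_mult) auto
    finally have "ln \<bar>det U\<bar> \<le> ln (fact n) + n * ln b + n * ln (1 + T)"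
      by (simp add: distrib_left)
    then have "J \<le> ln (fact n) + n * ln b + n * ln (1 + T) - (\<epsilon> * (T / (m + 1)) powr \<theta> - m * K)"
      using J Gsum by (simp add: log_det_potential_def)
    then have "T < x0"
      using x0[of T] by linarith
    then have "b * T \<le> b * x0"
      using b(1) by simp
    then show "\<bar>U $$ (k, l)\<bar> \<le> b * x0" if "k < n" "l < n" for k l
      using b(2)[OF U(1) that] unfolding T_def by linarith
  qed
qed

text \<open>The value at the identity fixes a superlevel set, whose matrices all have entry
  functions in a compact set on which the potential is continuous. A maximum there is global,
  because every other competitor lies below the identity.\<close>

lemma exists_maximizer:
  fixes a :: "nat \<Rightarrow> real vec"
  assumes a: "\<And>i. i < m \<Longrightarrow> a i \<in> carrier_vec n \<and> a i \<noteq> 0\<^sub>v n"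
    and span: "vec_span n (a ` {..<m}) = carrier_vec n"
    and pos: "0 < \<theta>" "0 < \<epsilon>"
    and cont: "\<And>i. i < m \<Longrightarrow> continuous_on {0<..} (G i)"
    and G: "\<And>i t. i < m \<Longrightarrow> 0 < t \<Longrightarrow> \<epsilon> * t powr \<theta> - K \<le> G i t"
  obtains U where "psd_mat n U" "det U \<noteq> 0"
    "\<And>V. psd_mat n V \<Longrightarrow> det V \<noteq> 0 \<Longrightarrow> log_det_potential m G a V \<le> log_det_potential m G a U"
proof -
  define F where "F = log_det_potential m G a"
  define J where "J = F (1\<^sub>m n)"
  obtain R \<delta> where \<delta>: "0 < \<delta>" and R\<delta>: "\<forall>U\<in>carrier_mat n n. det U \<noteq> 0 \<longrightarrow> J \<le> F U \<longrightarrow>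
      (\<forall>k<n. \<forall>l<n. \<bar>U $$ (k, l)\<bar> \<le> R) \<and> \<delta> \<le> \<bar>det U\<bar>"
    using log_det_potential_superlevel[where m = m and G = G and a = a and J = J, OF a span pos G]
    unfolding F_def by blast
  \<comment> \<open>Entry functions are padded by 0 outside the \<open>n\<close> by \<open>n\<close>
    block, and \<open>max R 0\<close> admits this padding whatever the sign of \<open>R\<close>. The
    bound \<delta> makes invertibility a closed condition.\<close>
  define S where "S = {h. \<forall>x. \<bar>h x\<bar> \<le> max R 0} \<inter> {h. psd_mat n (mat n n h)} \<inter> {h. \<delta> \<le> \<bar>det (mat n n h)\<bar>}"
  have entry: "\<exists>h\<in>S. mat n n h = V" if V: "psd_mat n V" "det V \<noteq> 0" "J \<le> F V" for V
  proof
    have eq: "mat n n (\<lambda>(i, j). if i < n \<and> j < n then V $$ (i, j) else 0) = V"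
      using psd_matD(1)[OF V(1)] by (intro eq_matI) auto
    then show "mat n n (\<lambda>(i, j). if i < n \<and> j < n then V $$ (i, j) else 0) = V" .
    show "(\<lambda>(i, j). if i < n \<and> j < n then V $$ (i, j) else 0) \<in> S"
      using V R\<delta>[rule_format, OF psd_matD(1)[OF V(1)]] by (auto simp: S_def eq le_max_iff_disj)
  qed
  have "compact S"
    unfolding S_def Int_assoc
    by (intro compact_Int_closed compact_cube closed_Int closed_psd_mat closed_Collect_le
        continuous_on_const continuous_on_rabs continuous_on_det_mat)
  moreover have "S \<noteq> {}"
    using entry[OF psd_mat_one] by (auto simp: J_def)
  moreover have "continuous_on S (\<lambda>h. F (mat n n h))"
    unfolding F_def log_det_potential_def
  proof (intro continuous_on_diff continuous_on_sum continuous_on_ln continuous_on_rabs continuous_on_det_mat ballI)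
    show "\<bar>det (mat n n h)\<bar> \<noteq> 0" if "h \<in> S" for h
      using that \<delta> by (auto simp: S_def)
    fix i assume i: "i \<in> {..<m}"
    show "continuous_on S (\<lambda>h. G i (norm2 (mat n n h *\<^sub>v a i)))"
    proof (rule continuous_on_compose2[OF cont])
      show "(\<lambda>h. norm2 (mat n n h *\<^sub>v a i)) ` S \<subseteq> {0<..}"
      proof (rule image_subsetI)
        fix h assume h: "h \<in> S"
        then have "det (mat n n h) \<noteq> 0"
          using \<delta> by (auto simp: S_def)
        then have "mat n n h *\<^sub>v a i \<noteq> 0\<^sub>v n"
          using det_0_iff_vec_prod_zero_field[OF mat_carrier, of n h] a[of i] i by auto
        then show "norm2 (mat n n h *\<^sub>v a i) \<in> {0<..}"
          using a[of i] i by (auto intro!: norm2_pos[of _ n] mult_mat_vec_carrier[of _ n n])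
      qed
    qed (use a i in \<open>auto intro!: continuous_on_norm2_mat_mult_vec\<close>)
  qed
  ultimately obtain h where h: "h \<in> S" "\<And>h'. h' \<in> S \<Longrightarrow> F (mat n n h') \<le> F (mat n n h)"
    using continuous_attains_sup[of S "\<lambda>h. F (mat n n h)"] by blast
  have max: "F V \<le> F (mat n n h)" if V: "psd_mat n V" "det V \<noteq> 0" "J \<le> F V" for V
    using entry[OF V] h(2) by auto
  have "J \<le> F (mat n n h)"
    unfolding J_def by (rule max[OF psd_mat_one]) (auto simp: J_def)
  then have "F V \<le> F (mat n n h)" if "psd_mat n V" "det V \<noteq> 0" for V
    using max[OF that] by linarith
  then show ?thesis
    using h(1) \<delta> by (intro that[of "mat n n h"]) (auto simp: S_def F_def)
qed

section \<open>From the maximiser to the approximate weight\<close>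

theorem theorem2p1:
  fixes \<theta> u c C :: real
  assumes "0 < \<theta>" and "\<theta> < u" and "0 < c" and "0 < C"
  shows "\<exists>\<alpha>>1. \<forall>m (f :: nat \<Rightarrow> real \<Rightarrow> real).
           (\<forall>i<m. (\<forall>z. 0 \<le> f i z) \<and> (\<exists>z>0. f i z \<noteq> 0) \<and>
                  lower_homogeneous \<theta> c (f i) \<and> upper_homogeneous u C (f i)) \<longrightarrow>
           (\<forall>n (a :: nat \<Rightarrow> real vec) s.
              (\<forall>i<m. a i \<in> carrier_vec n \<and> a i \<noteq> 0\<^sub>v n) \<longrightarrow>
              vec_span n (a ` {..<m}) = carrier_vec n \<longrightarrow>
              0 < s \<longrightarrow>
              (\<exists>w. approximate_weight n m f a \<alpha> s w))"
proof (intro exI[of _ "1 + max (1 / c) C"] conjI allI impI)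
  \<comment> \<open>The factor \<open>max (1 / c) C\<close> is the distortion between
    \<open>f i\<close> and its envelope; the added 1 secures \<alpha> > 1.\<close>
  define \<alpha> where "\<alpha> = 1 + max (1 / c) C"
  show "1 < 1 + max (1 / c) C"
    using assms by (simp add: less_max_iff_disj)
  fix m n :: nat and f :: "nat \<Rightarrow> real \<Rightarrow> real" and a :: "nat \<Rightarrow> real vec" and s :: real
  assume f: "\<forall>i<m. (\<forall>z. 0 \<le> f i z) \<and> (\<exists>z>0. f i z \<noteq> 0) \<and>
      lower_homogeneous \<theta> c (f i) \<and> upper_homogeneous u C (f i)"
    and a: "\<forall>i<m. a i \<in> carrier_vec n \<and> a i \<noteq> 0\<^sub>v n"
    and span: "vec_span n (a ` {..<m}) = carrier_vec n"
    and s: "0 < s"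
  have "\<forall>i<m. \<exists>G g \<epsilon> K. 0 < \<epsilon> \<and> (\<forall>t>0. (G has_real_derivative g t / t) (at t) \<and> 0 < f i t \<and>
      f i t \<le> g t \<and> g t \<le> max (1 / c) C * f i t \<and> \<epsilon> * t powr \<theta> - K \<le> G t)"
    using f assms by (intro allI impI homogeneous_potential[of \<theta> u c C]) auto
  then obtain G g \<epsilon> K where G: "\<And>i t. i < m \<Longrightarrow> 0 < t \<Longrightarrow> (G i has_real_derivative g i t / t) (at t)"
    and fg: "\<And>i t. i < m \<Longrightarrow> 0 < t \<Longrightarrow> 0 < f i t \<and> f i t \<le> g i t \<and> g i t \<le> max (1 / c) C * f i t"
    and coercive: "\<And>i t. i < m \<Longrightarrow> 0 < t \<Longrightarrow> \<epsilon> i * t powr \<theta> - K i \<le> G i t"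
    and \<epsilon>: "\<And>i. i < m \<Longrightarrow> 0 < \<epsilon> i"
    by metis
  \<comment> \<open>The existence lemma wants coercivity constants common to all \<open>i\<close>.
    Inserting 1 keeps the minimum defined for \<open>m = 0\<close>; neither constant enters
    \<alpha>.\<close>
  define \<epsilon>' where "\<epsilon>' = Min (insert 1 (\<epsilon> ` {..<m}))"
  define K' where "K' = (\<Sum>i<m. \<bar>K i\<bar>)"
  have "0 < \<epsilon>'"
    using \<epsilon> by (auto simp: \<epsilon>'_def)
  \<comment> \<open>Dividing the potentials by \<open>s\<close> puts the factor \<open>1 / s\<close>
    into the weights, and this realises the scale \<open>s\<close>.\<close>
  have Gs: "((\<lambda>t. G i t / s) has_real_derivative g i t / s / t) (at t)" if "i < m" "0 < t" for i t
    using DERIV_cdivide[OF G[OF that], of s] by (simp add: mult.commute)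
  obtain U where U: "psd_mat n U" "det U \<noteq> 0" and max: "\<And>V. psd_mat n V \<Longrightarrow> det V \<noteq> 0 \<Longrightarrow>
      log_det_potential m (\<lambda>i t. G i t / s) a V \<le> log_det_potential m (\<lambda>i t. G i t / s) a U"
  proof (rule exists_maximizer[of m a n \<theta> "\<epsilon>' / s" "\<lambda>i t. G i t / s" "K' / s"])
    fix i t assume it: "i < m" "0 < (t :: real)"
    have "\<epsilon>' \<le> \<epsilon> i" "K i \<le> K'"
      using it member_le_sum[of i "{..<m}" "\<lambda>i. \<bar>K i\<bar>"] by (auto simp: \<epsilon>'_def K'_def)
    then have "\<epsilon>' * t powr \<theta> - K' \<le> \<epsilon> i * t powr \<theta> - K i"
      by (intro diff_mono mult_right_mono) auto
    also have "\<dots> \<le> G i t"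
      by (rule coercive[OF it])
    finally show "\<epsilon>' / s * t powr \<theta> - K' / s \<le> G i t / s"
      using s by (simp add: divide_simps)
  next
    show "continuous_on {0<..} (\<lambda>t. G i t / s)" if "i < m" for i
      using Gs[OF that] by (intro DERIV_continuous_on[of _ _ "\<lambda>t. g i t / s / t"])
        (auto intro: has_field_derivative_at_within)
  qed (use a span s \<open>0 < \<epsilon>'\<close> assms in auto)
  define w where "w = vec m (\<lambda>i. g i (norm2 (U *\<^sub>v a i)) / s / (norm2 (U *\<^sub>v a i))\<^sup>2)"
  have "U * weight_mat n m a w * U = 1\<^sub>m n"
    unfolding w_def using a Gs max by (intro maximizer_sandwich U) auto
  note M = inv_sqrt_mat_eqI[OF U weight_mat_carrier this]
  have t: "0 < norm2 (U *\<^sub>v a i)" if "i < m" for i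
    using det_0_iff_vec_prod_zero_field[OF psd_matD(1)[OF U(1)]] U that a
    by (intro norm2_pos[of _ n]) (auto simp: square_carrier psd_matD(1))
  have "approximate_weight n m f a \<alpha> s w"
    unfolding approximate_weight_def Let_def M(2)
  proof (intro conjI allI impI M(1))
    fix i assume i: "i < m"
    define t where "t = norm2 (U *\<^sub>v a i)"
    have t0: "0 < t"
      using t[OF i] by (simp add: t_def)
    note fgt = fg[OF i t0]
    have wt: "w $ i = g i t / s / t\<^sup>2"
      using i by (simp add: w_def t_def)
    show "0 < w $ i"
      using fgt s t0 by (simp add: wt)
    \<comment> \<open>For the envelopes the weight is exact, as
      \<open>w $ i * t\<^sup>2 = g i t / s\<close>. The quotient for \<open>f i\<close> thus differs
      from \<open>s\<close> only by the ratio of \<open>f i\<close> to \<open>g i\<close>.\<close>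
    have q: "f i t / (w $ i * t\<^sup>2) = s * (f i t / g i t)"
      using s t0 by (simp add: wt)
    have "1 * f i t \<le> \<alpha> * g i t"
      using fgt assms by (intro mult_mono) (auto simp: \<alpha>_def)
    moreover have "g i t \<le> \<alpha> * f i t"
      using fgt by (simp add: \<alpha>_def distrib_right)
    moreover have "0 < \<alpha>"
      using assms by (simp add: \<alpha>_def add_pos_pos less_max_iff_disj)
    ultimately show "s / \<alpha> \<le> f i (norm2 (U *\<^sub>v a i)) / (w $ i * (norm2 (U *\<^sub>v a i))\<^sup>2)"
      "f i (norm2 (U *\<^sub>v a i)) / (w $ i * (norm2 (U *\<^sub>v a i))\<^sup>2) \<le> \<alpha> * s"
      unfolding t_def[symmetric] q using fgt s by (simp_all add: field_simps)
  qed (simp add: w_def)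
  then show "\<exists>w. approximate_weight n m f a (1 + max (1 / c) C) s w"
    unfolding \<alpha>_def by blast
qed

end
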